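(* Let $\widetilde{\mathcal T},\mathcal T\in\mathbb R^{p_1\times\cdots\times p_d}$, where $\mathcal T$ has Tucker rank $\mathbf r^*=(r_1^*,\dots,r_d^* )$ with Tucker decomposition $\mathcal T=\mathcal B\times_1U_1\times\cdots\times_dU_d$, $\mathcal B\in\mathbb R^{r_1^*\times\cdots\times r_d^*}$, $U_k\in\mathbb O_{p_k,r_k^*}$. Let $\mathcal Z=\widetilde{\mathcal T}-\mathcal T$. Let $\mathbf r=(r_1,\dots,r_d)\ge\mathbf r^*$ entrywise and let $\widetilde U_k^0\in\mathbb O_{p_k,r_k}$, $k=1,\dots,d$, satisfy $\max_{k=1,\dots,d}\|\widetilde U_{k\perp}^{0\top}U_k\|\le\frac{\sqrt2}2$. Let $\widehat{\mathcal T}$ be the output of one-iteration higher-order orthogonal iteration (OHOOI) with inputs $\widetilde{\mathcal T}$, $\mathbf r$ and $\{\widetilde U_k^0\}_{k=1}^d$. Then $$\|\widehat{\mathcal T}-\mathcal T\|_F\le\big(2^{\frac{d+1}2}\cdot d+1\big)\|\mathcal Z_{\max(\mathbf r)}\|_F .$$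
   Context: $\mathbb O_{p,r}$ is the set of $p\times r$ matrices with orthonormal columns; $U_\perp\in\mathbb O_{p,p-r}$ is an orthonormal complement of $U\in\mathbb O_{p,r}$; $P_U=UU^\top$; $\|\cdot\|$ is the spectral norm. $\mathcal M_k$ is the mode-$k$ matricization, $\times_k$ the mode-$k$ tensor–matrix product, Tucker rank the tuple of ranks of the matricizations. $\mathrm{SVD}_r(D)$ is the matrix of the leading $r$ left singular vectors of $D$. $\mathcal Z_{\max(\mathbf r)}$ is a best Frobenius-norm approximation of $\mathcal Z$ by tensors of Tucker rank at most $\mathbf r$; $\|\mathcal Z_{\max(\mathbf r)}\|_F=\max_{U_k'\in\mathbb O_{p_k,r_k}}\|\mathcal Z\times_{k=1}^dP_{U_k'}\|_F$. OHOOI: for $k=1,\dots,d$ compute $\widetilde U_k^1=\mathrm{SVD}_{r_k}\big(\mathcal M_k(\widetilde{\mathcal T}\times_{j<k}(\widetilde U_j^0)^\top\times_{j>k}(\widetilde U_j^0)^\top)\big)$; output $\widehat{\mathcal T}=\widetilde{\mathcal T}\times_{k=1}^dP_{\widetilde U_k^1}$. *)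

theory Defs
  imports Complex_Main "HOL-Library.FuncSet" "Jordan_Normal_Form.DL_Rank"
begin

section \<open>Matrices\<close>

definition orthonormal_cols :: "nat \<Rightarrow> nat \<Rightarrow> real mat set" where
  "orthonormal_cols p r = {U \<in> carrier_mat p r. transpose_mat U * U = 1\<^sub>m r}"

definition orthonormal_complement :: "nat \<Rightarrow> nat \<Rightarrow> real mat \<Rightarrow> real mat \<Rightarrow> bool" where
  "orthonormal_complement p r U V \<longleftrightarrow>
     V \<in> orthonormal_cols p (p - r) \<and> transpose_mat U * V = 0\<^sub>m r (p - r)"

definition proj_mat :: "real mat \<Rightarrow> real mat" where
  "proj_mat U = U * transpose_mat U"

definition vec_norm2 :: "real vec \<Rightarrow> real" where
  "vec_norm2 x = sqrt (x \<bullet> x)"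

text \<open>The supremum runs over the closed unit ball rather than the unit sphere so that
  matrices without columns get norm 0.\<close>

definition spectral_norm :: "real mat \<Rightarrow> real" where
  "spectral_norm A =
     Sup {vec_norm2 (A *\<^sub>v x) | x. x \<in> carrier_vec (dim_col A) \<and> vec_norm2 x \<le> 1}"

definition is_SVD :: "real mat \<Rightarrow> real mat \<Rightarrow> (nat \<Rightarrow> real) \<Rightarrow> real mat \<Rightarrow> bool" where
  "is_SVD D Q s V \<longleftrightarrow>
     Q \<in> orthonormal_cols (dim_row D) (dim_row D) \<and>
     V \<in> orthonormal_cols (dim_col D) (dim_col D) \<and>
     (\<forall>i < min (dim_row D) (dim_col D). 0 \<le> s i) \<and>
     (\<forall>i j. i \<le> j \<longrightarrow> j < min (dim_row D) (dim_col D) \<longrightarrow> s j \<le> s i) \<and>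
     D = Q * mat (dim_row D) (dim_col D) (\<lambda>(i, j). if i = j then s i else 0) * transpose_mat V"

text \<open>Leading left singular vectors are not unique, so \<open>SVD\<^sub>r(D)\<close> is rendered as the
  relation ``\<open>W\<close> consists of the first \<open>r\<close> left singular vectors of some full singular value
  decomposition of \<open>D\<close>''. The full decomposition is needed because \<open>r\<close> may exceed the
  number of columns of \<open>D\<close>.\<close>

definition is_SVD_left :: "nat \<Rightarrow> real mat \<Rightarrow> real mat \<Rightarrow> bool" where
  "is_SVD_left r D W \<longleftrightarrow>
     r \<le> dim_row D \<and>
     (\<exists>Q s V. is_SVD D Q s V \<and> W = mat (dim_row D) r (\<lambda>(i, j). Q $$ (i, j)))"

section \<open>Tensors\<close>

text \<open>A tensor of order \<open>d\<close> with dimensions \<open>p 0, \<dots>, p (d - 1)\<close> is a function on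
  multi-indices that vanishes outside the index set. Modes and entries are counted from 0.\<close>

type_synonym tensor = "(nat \<Rightarrow> nat) \<Rightarrow> real"

definition multi_indices :: "nat \<Rightarrow> (nat \<Rightarrow> nat) \<Rightarrow> (nat \<Rightarrow> nat) set" where
  "multi_indices d p = (\<Pi>\<^sub>E k\<in>{..<d}. {..<p k})"

definition tensors :: "nat \<Rightarrow> (nat \<Rightarrow> nat) \<Rightarrow> tensor set" where
  "tensors d p = {T. \<forall>i. i \<notin> multi_indices d p \<longrightarrow> T i = 0}"

definition tensor_diff :: "tensor \<Rightarrow> tensor \<Rightarrow> tensor" where
  "tensor_diff S T = (\<lambda>i. S i - T i)"

definition fro_norm :: "nat \<Rightarrow> (nat \<Rightarrow> nat) \<Rightarrow> tensor \<Rightarrow> real" where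
  "fro_norm d p T = sqrt (\<Sum>i\<in>multi_indices d p. (T i)\<^sup>2)"

text \<open>For \<open>k < d\<close>, \<open>T \<in> tensors d p\<close> and \<open>A\<close> with \<open>p k\<close> columns the result lies in
  \<open>tensors d (p(k := dim_row A))\<close>; out-of-range indices in the modes other than \<open>k\<close> yield 0
  because \<open>T\<close> does.\<close>

definition mode_prod :: "nat \<Rightarrow> real mat \<Rightarrow> tensor \<Rightarrow> tensor" where
  "mode_prod k A T =
     (\<lambda>i. if i k < dim_row A then \<Sum>a<dim_col A. A $$ (i k, a) * T (i(k := a)) else 0)"

definition mode_prods :: "nat list \<Rightarrow> (nat \<Rightarrow> real mat) \<Rightarrow> tensor \<Rightarrow> tensor" where
  "mode_prods ks A T = fold (\<lambda>k. mode_prod k (A k)) ks T"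

text \<open>Column \<open>c\<close> of the mode-\<open>k\<close> matricization carries the multi-index \<open>(i\<^sub>l)\<close>, \<open>l \<noteq> k\<close>, with
  \<open>c = \<Sum>\<^bsub>l \<noteq> k\<^esub> i\<^sub>l * \<Prod>\<^bsub>m < l, m \<noteq> k\<^esub> p\<^sub>m\<close>, so that earlier modes vary fastest.\<close>

definition matricize :: "nat \<Rightarrow> (nat \<Rightarrow> nat) \<Rightarrow> nat \<Rightarrow> tensor \<Rightarrow> real mat" where
  "matricize d p k T =
     mat (p k) (\<Prod>j\<in>{..<d} - {k}. p j)
       (\<lambda>(a, c). T (\<lambda>l\<in>{..<d}. if l = k then a else (c div (\<Prod>m\<in>{..<l} - {k}. p m)) mod p l))"

definition tucker_rank :: "nat \<Rightarrow> (nat \<Rightarrow> nat) \<Rightarrow> tensor \<Rightarrow> nat \<Rightarrow> nat" where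
  "tucker_rank d p T k = vec_space.rank (p k) (matricize d p k T)"

definition is_best_tucker_approx ::
    "nat \<Rightarrow> (nat \<Rightarrow> nat) \<Rightarrow> (nat \<Rightarrow> nat) \<Rightarrow> tensor \<Rightarrow> tensor \<Rightarrow> bool" where
  "is_best_tucker_approx d p r Z Y \<longleftrightarrow>
     Y \<in> tensors d p \<and> (\<forall>k<d. tucker_rank d p Y k \<le> r k) \<and>
     (\<forall>X\<in>tensors d p. (\<forall>k<d. tucker_rank d p X k \<le> r k) \<longrightarrow>
        fro_norm d p (tensor_diff Z Y) \<le> fro_norm d p (tensor_diff Z X))"

text \<open>\<open>r(k := p k)\<close> are the dimensions of the tensor after all modes but \<open>k\<close> are compressed.\<close>

definition is_OHOOI_output ::
    "nat \<Rightarrow> (nat \<Rightarrow> nat) \<Rightarrow> (nat \<Rightarrow> nat) \<Rightarrow> tensor \<Rightarrow> (nat \<Rightarrow> real mat) \<Rightarrow> tensor \<Rightarrow> bool" where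
  "is_OHOOI_output d p r T U0 That \<longleftrightarrow>
     (\<exists>U1. (\<forall>k<d. is_SVD_left (r k)
                (matricize d (r(k := p k)) k
                   (mode_prods ([0..<k] @ [Suc k..<d]) (\<lambda>j. transpose_mat (U0 j)) T))
                (U1 k)) \<and>
           That = mode_prods [0..<d] (\<lambda>k. proj_mat (U1 k)) T)"

end

theory Submission
  imports Defs "HOL-Analysis.L2_Norm"
begin

text \<open>Write \<open>z\<close> for the norm of \<open>Zmax\<close>. Optimality of \<open>Zmax\<close> under rescaling of competitors gives
  \<open>\<langle>Z, X\<rangle> \<le> z * \<parallel>X\<parallel>\<close> for every \<open>X\<close> of Tucker rank at most \<open>r\<close>; in particular every projection of
  \<open>Z\<close> onto subspaces of dimensions at most \<open>r\<close> has norm at most \<open>z\<close>. Let \<open>P\<^sub>k\<close> denote the projection onto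
  the columns of the \<open>k\<close>-th output of the iteration. The error is the projection of \<open>Z\<close> by all the
  \<open>P\<^sub>k\<close>, plus a term that telescopes into the residuals \<open>T - P\<^sub>k T\<close> in the single modes. On the column
  space of \<open>U\<^sub>j\<close> the compression by the transpose of \<open>U0\<^sub>j\<close> shrinks norms by at most \<open>sqrt 2\<close>, so a residual is at most
  \<open>2 powr ((d - 1) / 2)\<close> times the residual of the compressed signal \<open>A\<close>.

  For the latter let \<open>M = A + E\<close> be the compressed observation, \<open>Q\<close> its leading left singular vectors and
  \<open>U\<close> an orthonormal basis containing the columns of \<open>A\<close> in its span. With \<open>W\<close> and \<open>V\<close> orthonormal bases of
  the ranges of \<open>(1 - QQ\<^sup>T) U\<close> and \<open>(1 - UU\<^sup>T) Q\<close> one has \<open>QQ\<^sup>T + WW\<^sup>T = UU\<^sup>T + VV\<^sup>T\<close>. Ky Fan's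
  inequality \<open>\<parallel>U\<^sup>T M\<parallel> \<le> \<parallel>Q\<^sup>T M\<parallel>\<close> therefore gives \<open>\<parallel>W\<^sup>T M\<parallel> \<le> \<parallel>V\<^sup>T M\<parallel> = \<parallel>V\<^sup>T E\<parallel> \<le> z\<close>, and
  \<open>(1 - QQ\<^sup>T) A = WW\<^sup>T A = WW\<^sup>T M - WW\<^sup>T E\<close> has norm at most \<open>2 * z\<close>.\<close>


section \<open>Matrices with orthonormal columns\<close>

text \<open>Every column of \<open>A * B\<close> is \<open>A\<close> applied to a column of
  \<open>B\<close>, so the column spaces are nested, and dimension is monotone along nested
  subspaces.\<close>

lemma (in vec_space) rank_mult_le:
  assumes A: "A \<in> carrier_mat n k" and B: "B \<in> carrier_mat k m"
  shows "rank (A * B) \<le> rank A"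
proof -
  let ?S = "span (set (cols A))" and ?T = "span (set (cols (A * B)))"
  have AB: "A * B \<in> carrier_mat n m" using A B by simp
  have cA: "set (cols A) \<subseteq> carrier_vec n" and cAB: "set (cols (A * B)) \<subseteq> carrier_vec n"
    using A AB cols_dim by blast+
  have "set (cols (A * B)) \<subseteq> ?S"
  proof
    fix x assume "x \<in> set (cols (A * B))"
    then obtain i where i: "i < m" "x = col (A * B) i"
      using AB by (metis carrier_matD(2) cols_length cols_nth in_set_conv_nth)
    then have "x = A *\<^sub>v col B i" using col_mult2[OF A B] by metis
    then show "x \<in> ?S"
      using col_space_eq[OF A] A B unfolding col_space_def by fastforce
  qed
  then have sub: "?T \<subseteq> ?S" using cA span_subsetI by blast
  have S: "VectorSpace.subspace class_ring ?S V" and T: "VectorSpace.subspace class_ring ?T V"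
    using cA cAB span_is_subspace by auto
  then have "VectorSpace.subspace class_ring ?T (vs ?S)" using nested_subspaces sub by blast
  then show ?thesis unfolding rank_def
    using vectorspace.subspace_dim[OF subspace_is_vs[OF S]]
      fin_dim_span_cols[OF A] fin_dim_span_cols[OF AB] by auto
qed

lemma orthonormal_colsD:
  assumes "U \<in> orthonormal_cols p r"
  shows "U \<in> carrier_mat p r" "transpose_mat U * U = 1\<^sub>m r"
  using assms by (auto simp: orthonormal_cols_def)

lemma proj_mat_carrier: "U \<in> carrier_mat p r \<Longrightarrow> proj_mat U \<in> carrier_mat p p"
  by (simp add: proj_mat_def)

lemma transpose_proj_mat: "transpose_mat (proj_mat U) = proj_mat U"
  unfolding proj_mat_def by (subst transpose_mult[of U _ "dim_col U"]) auto

lemma proj_mat_mult_self: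
  assumes "U \<in> orthonormal_cols p r"
  shows "proj_mat U * U = U" "transpose_mat U * proj_mat U = transpose_mat U"
proof -
  note U = orthonormal_colsD[OF assms]
  show "proj_mat U * U = U" unfolding proj_mat_def
    using U by (subst assoc_mult_mat[of _ p r _ p _ r]) auto
  show "transpose_mat U * proj_mat U = transpose_mat U" unfolding proj_mat_def
    using U by (subst assoc_mult_mat[of _ r p _ r _ p, symmetric]) auto
qed

lemma proj_mat_idem:
  assumes "U \<in> orthonormal_cols p r"
  shows "proj_mat U * proj_mat U = proj_mat U"
proof -
  note U = orthonormal_colsD[OF assms]
  have "proj_mat U * (U * transpose_mat U) = proj_mat U * U * transpose_mat U"
    using U by (subst assoc_mult_mat[of _ p p _ r _ p]) (auto simp: proj_mat_def)
  then show ?thesis using proj_mat_mult_self[OF assms] by (simp add: proj_mat_def)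
qed

section \<open>Orthonormal bases of column spaces\<close>

text \<open>Passes from annihilation of a matrix to conditions on single vectors, the form in which
  the Gram-Schmidt step describes spans.\<close>

lemma mult_eq_0_iff_rows:
  fixes A :: "real mat"
  assumes "A \<in> carrier_mat l p" "B \<in> carrier_mat p n"
  shows "A * B = 0\<^sub>m l n \<longleftrightarrow> (\<forall>i<l. transpose_mat B *\<^sub>v row A i = 0\<^sub>v n)"
proof -
  have *: "(A * B) $$ (i, j) = (transpose_mat B *\<^sub>v row A i) $ j" if "i < l" "j < n" for i j
    using assms that by (simp add: comm_scalar_prod[of _ p])
  show ?thesis
  proof
    assume h: "A * B = 0\<^sub>m l n"
    show "\<forall>i<l. transpose_mat B *\<^sub>v row A i = 0\<^sub>v n"
    proof (intro allI impI eq_vecI)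
      fix i j assume "i < l" "j < dim_vec (0\<^sub>v n :: real vec)"
      then show "(transpose_mat B *\<^sub>v row A i) $ j = 0\<^sub>v n $ j" using *[of i j] h by simp
    qed (use assms in simp)
  next
    assume h: "\<forall>i<l. transpose_mat B *\<^sub>v row A i = 0\<^sub>v n"
    show "A * B = 0\<^sub>m l n"
    proof (rule eq_matI)
      fix i j assume "i < dim_row (0\<^sub>m l n :: real mat)" "j < dim_col (0\<^sub>m l n :: real mat)"
      then show "(A * B) $$ (i, j) = 0\<^sub>m l n $$ (i, j)" using *[of i j] h by simp
    qed (use assms in auto)
  qed
qed

text \<open>The span is described by its orthogonal complement, which makes one Gram--Schmidt step a
  statement about single vectors.\<close>

lemma gram_schmidt_orthonormal:
  fixes vs :: "real vec list"
  assumes "set vs \<subseteq> carrier_vec p"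
  shows "\<exists>W m. m \<le> length vs \<and> W \<in> orthonormal_cols p m \<and>
    (\<forall>x\<in>carrier_vec p. transpose_mat W *\<^sub>v x = 0\<^sub>v m \<longleftrightarrow> (\<forall>v\<in>set vs. v \<bullet> x = 0))"
  using assms
proof (induction vs)
  case Nil
  have "0\<^sub>m p 0 \<in> orthonormal_cols p 0"
    by (auto simp: orthonormal_cols_def intro!: eq_matI)
  then show ?case by (intro exI[of _ "0\<^sub>m p 0"] exI[of _ 0]) (auto intro!: eq_vecI)
next
  case (Cons v vs)
  then obtain W m where m: "m \<le> length vs" and W: "W \<in> orthonormal_cols p m"
    and eqv: "\<And>x. x \<in> carrier_vec p \<Longrightarrow>
      transpose_mat W *\<^sub>v x = 0\<^sub>v m \<longleftrightarrow> (\<forall>v\<in>set vs. v \<bullet> x = 0)" by auto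
  have v: "v \<in> carrier_vec p" using Cons.prems by simp
  note Wc = orthonormal_colsD[OF W]
  \<comment> \<open>The part of \<open>v\<close> orthogonal to the columns of \<open>W\<close>; it
    vanishes exactly when \<open>v\<close> adds nothing to the span.\<close>
  define u where "u = v - proj_mat W *\<^sub>v v"
  have u: "u \<in> carrier_vec p"
    using proj_mat_carrier[OF Wc(1)] v unfolding u_def by auto
  have Wu: "transpose_mat W *\<^sub>v u = 0\<^sub>v m"
  proof -
    have "transpose_mat W *\<^sub>v u = transpose_mat W *\<^sub>v v - transpose_mat W *\<^sub>v (proj_mat W *\<^sub>v v)"
      unfolding u_def using Wc(1) v proj_mat_carrier[OF Wc(1)]
      by (subst mult_minus_distrib_mat_vec[of _ m p]) auto
    also have "transpose_mat W *\<^sub>v (proj_mat W *\<^sub>v v) = transpose_mat W *\<^sub>v v"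
      using Wc(1) v proj_mat_carrier[OF Wc(1)] proj_mat_mult_self(2)[OF W]
      by (subst assoc_mult_mat_vec[of _ m p _ p, symmetric]) auto
    finally show ?thesis using Wc(1) v by simp
  qed
  \<comment> \<open>For \<open>x\<close> orthogonal to \<open>W\<close> the projected part of
    \<open>v\<close> is invisible, so \<open>u\<close> and \<open>v\<close> impose the same
    condition on \<open>x\<close>.\<close>
  have xu: "u \<bullet> x = v \<bullet> x" if "x \<in> carrier_vec p" "transpose_mat W *\<^sub>v x = 0\<^sub>v m" for x
  proof -
    have "(proj_mat W *\<^sub>v v) \<bullet> x = (W *\<^sub>v (transpose_mat W *\<^sub>v v)) \<bullet> x"
      using Wc(1) v unfolding proj_mat_def by (subst assoc_mult_mat_vec[of _ p m _ p]) auto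
    also have "\<dots> = (transpose_mat W *\<^sub>v v) \<bullet> (transpose_mat W *\<^sub>v x)"
      using Wc(1) v that transpose_vec_mult_scalar[of W p m "transpose_mat W *\<^sub>v v" x]
      by (simp add: comm_scalar_prod[of _ m] comm_scalar_prod[of _ p])
    also have "\<dots> = 0" using that Wc(1) v by simp
    finally show ?thesis unfolding u_def
      using that v proj_mat_carrier[OF Wc(1)] by (subst minus_scalar_prod_distrib[of _ p]) auto
  qed
  show ?case
  proof (cases "u = 0\<^sub>v p")
    case True
    have "v \<bullet> x = 0" if "x \<in> carrier_vec p" "transpose_mat W *\<^sub>v x = 0\<^sub>v m" for x
      using xu[OF that] True that(1) by simp
    then show ?thesis using m W eqv by (intro exI[of _ W] exI[of _ m]) auto
  next
    case False
    have uu: "u \<bullet> u > 0"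
    proof -
      obtain i where "i < p" "u $ i \<noteq> 0" using False u by (auto simp: vec_eq_iff)
      then show ?thesis unfolding scalar_prod_def
        using u by (intro sum_pos2[of _ i]) (auto simp: zero_less_mult_iff)
    qed
    define c where "c = inverse (sqrt (u \<bullet> u))"
    have c: "c \<noteq> 0" "c * c * (u \<bullet> u) = 1"
      using uu unfolding c_def by (auto simp: field_simps)
    define W' where "W' = mat p (Suc m) (\<lambda>(i, j). if j < m then W $$ (i, j) else c * u $ i)"
    have W'c: "W' \<in> carrier_mat p (Suc m)" by (simp add: W'_def)
    have colm: "col W' m = c \<cdot>\<^sub>v u" and colj: "\<And>j. j < m \<Longrightarrow> col W' j = col W j"
      using u Wc(1) by (auto simp: W'_def intro!: eq_vecI)
    have Wu': "col W j \<bullet> u = 0" if "j < m" for j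
      using arg_cong[OF Wu, of "\<lambda>x. x $ j"] that Wc(1) by simp
    have W': "W' \<in> orthonormal_cols p (Suc m)"
    proof -
      have "transpose_mat W' * W' = 1\<^sub>m (Suc m)"
      proof (rule eq_matI)
        fix i j assume "i < dim_row (1\<^sub>m (Suc m) :: real mat)" "j < dim_col (1\<^sub>m (Suc m) :: real mat)"
        then have ij: "i < Suc m" "j < Suc m" by auto
        have WW: "col W i \<bullet> col W j = (if i = j then 1 else 0)" if "i < m" "j < m"
          using arg_cong[OF Wc(2), of "\<lambda>x. x $$ (i, j)"] that Wc(1) by simp
        have "(transpose_mat W' * W') $$ (i, j) = col W' i \<bullet> col W' j" using ij W'c by simp
        also have "\<dots> = (if i = j then 1 else 0)"
        proof -
          consider "i < m" "j < m" | "i < m" "j = m" | "i = m" "j < m" | "i = m" "j = m"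
            using ij by linarith
          then show ?thesis
          proof cases
            case 1
            then show ?thesis using colj WW by simp
          next
            case 2
            then show ?thesis using colj colm Wu' u Wc(1) by simp
          next
            case 3
            then have "u \<bullet> col W j = 0" using Wu' u Wc(1) comm_scalar_prod[of u p "col W j"] by simp
            then show ?thesis using 3 colj colm u Wc(1) by simp
          next
            case 4
            then show ?thesis using colm c u by (simp add: mult.assoc)
          qed
        qed
        finally show "(transpose_mat W' * W') $$ (i, j) = 1\<^sub>m (Suc m) $$ (i, j)" using ij by simp
      qed (use W'c in auto)
      then show ?thesis using W'c by (simp add: orthonormal_cols_def)
    qed
    have W'x: "transpose_mat W' *\<^sub>v x = 0\<^sub>v (Suc m) \<longleftrightarrow> transpose_mat W *\<^sub>v x = 0\<^sub>v m \<and> u \<bullet> x = 0"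
      if x: "x \<in> carrier_vec p" for x
    proof -
      have "transpose_mat W' *\<^sub>v x = 0\<^sub>v (Suc m) \<longleftrightarrow> (\<forall>j<Suc m. col W' j \<bullet> x = 0)"
        using W'c by (auto simp: vec_eq_iff)
      also have "\<dots> \<longleftrightarrow> (\<forall>j<m. col W j \<bullet> x = 0) \<and> c * (u \<bullet> x) = 0"
        using colm colj u x by (auto simp: less_Suc_eq)
      also have "(\<forall>j<m. col W j \<bullet> x = 0) \<longleftrightarrow> transpose_mat W *\<^sub>v x = 0\<^sub>v m"
        using Wc(1) by (auto simp: vec_eq_iff)
      finally show ?thesis using c by simp
    qed
    show ?thesis
    proof (intro exI[of _ W'] exI[of _ "Suc m"] conjI ballI)
      fix x :: "real vec" assume x: "x \<in> carrier_vec p"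
      show "transpose_mat W' *\<^sub>v x = 0\<^sub>v (Suc m) \<longleftrightarrow> (\<forall>v\<in>set (v # vs). v \<bullet> x = 0)"
        using W'x[OF x] eqv[OF x] xu[OF x] by auto
    qed (use m W' in auto)
  qed
qed

text \<open>The last conclusion is the inclusion of the range of \<open>W\<close> in that of
  \<open>M\<close>, put without spans: whatever annihilates \<open>M\<close> annihilates
  \<open>W\<close>. The columns of \<open>M\<close> may be dependent, so \<open>m\<close> may be
  smaller than \<open>n\<close>.\<close>

lemma orthonormal_range_basis:
  fixes M :: "real mat"
  assumes M: "M \<in> carrier_mat p n"
  obtains W m where "m \<le> n" "W \<in> orthonormal_cols p m" "proj_mat W * M = M"
    "\<And>K l. K \<in> carrier_mat l p \<Longrightarrow> K * M = 0\<^sub>m l n \<Longrightarrow> K * W = 0\<^sub>m l m"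
proof -
  have "set (cols M) \<subseteq> carrier_vec p" using M cols_dim by blast
  from gram_schmidt_orthonormal[OF this] obtain W m where m: "m \<le> n"
    and W: "W \<in> orthonormal_cols p m"
    and eqv: "\<And>x. x \<in> carrier_vec p \<Longrightarrow>
      transpose_mat W *\<^sub>v x = 0\<^sub>v m \<longleftrightarrow> (\<forall>v\<in>set (cols M). v \<bullet> x = 0)"
    using M by auto
  note Wc = orthonormal_colsD[OF W]
  have eqv': "transpose_mat W *\<^sub>v x = 0\<^sub>v m \<longleftrightarrow> transpose_mat M *\<^sub>v x = 0\<^sub>v n"
    if "x \<in> carrier_vec p" for x
    unfolding eqv[OF that] using M by (auto simp: vec_eq_iff cols_def)
  have iff: "K * M = 0\<^sub>m l n \<longleftrightarrow> K * W = 0\<^sub>m l m" if "K \<in> carrier_mat l p" for K l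
    unfolding mult_eq_0_iff_rows[OF that M] mult_eq_0_iff_rows[OF that Wc(1)]
    using eqv' that by (metis row_carrier_vec)
  \<comment> \<open>This complement annihilates \<open>W\<close>, hence also \<open>M\<close>, which
    puts the columns of \<open>M\<close> into the range of \<open>W\<close>.\<close>
  let ?K = "1\<^sub>m p - proj_mat W"
  have K: "?K \<in> carrier_mat p p" using proj_mat_carrier[OF Wc(1)] by auto
  have "?K * W = 0\<^sub>m p m"
    using Wc(1) proj_mat_carrier[OF Wc(1)] proj_mat_mult_self(1)[OF W]
    by (subst minus_mult_distrib_mat[of _ p p]) auto
  then have "?K * M = 0\<^sub>m p n" using iff[OF K] by simp
  then have "M - proj_mat W * M = 0\<^sub>m p n"
    using M proj_mat_carrier[OF Wc(1)] by (subst (asm) minus_mult_distrib_mat[of _ p p]) auto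
  then have "proj_mat W * M = M"
    using M proj_mat_carrier[OF Wc(1)] by (auto simp: mat_eq_iff)
  then show thesis using that m W iff by blast
qed

section \<open>Frobenius norms of matrices and Ky Fan's inequality\<close>

definition fro_sq :: "real mat \<Rightarrow> real" where
  "fro_sq M = (\<Sum>a<dim_row M. \<Sum>c<dim_col M. (M $$ (a, c))\<^sup>2)"

lemma fro_sq_diag: "fro_sq M = (\<Sum>a<dim_row M. (M * transpose_mat M) $$ (a, a))"
  unfolding fro_sq_def
  by (intro sum.cong) (auto simp: scalar_prod_def power2_eq_square lessThan_atLeast0)

text \<open>The orthogonal factor cancels in the product with the transpose, whose trace is the
  squared norm.\<close>

lemma fro_sq_mult_orthogonal:
  assumes X: "X \<in> carrier_mat m n" and V: "V \<in> orthonormal_cols n n"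
  shows "fro_sq (X * transpose_mat V) = fro_sq X"
proof -
  note Vc = orthonormal_colsD[OF V]
  have "X * transpose_mat V * transpose_mat (X * transpose_mat V)
      = X * transpose_mat V * (V * transpose_mat X)"
    using X Vc by (subst transpose_mult[of X m n _ n]) auto
  also have "\<dots> = X * (transpose_mat V * (V * transpose_mat X))"
    using X Vc by (subst assoc_mult_mat[of _ m n _ n _ m]) auto
  also have "transpose_mat V * (V * transpose_mat X) = transpose_mat V * V * transpose_mat X"
    using X Vc by (subst assoc_mult_mat[of _ n n _ n _ m]) auto
  also have "\<dots> = transpose_mat X" using X Vc by simp
  finally show ?thesis using X Vc by (simp add: fro_sq_diag)
qed

text \<open>A fractional knapsack argument by duality: with a threshold \<open>l\<close> as
  multiplier for the total weight, each \<open>w i * t i\<close> is at most \<open>l * w i\<close>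
  plus the excess of \<open>t i\<close> over \<open>l\<close>, the latter counted for leading
  indices only.\<close>

lemma sum_weights_le_leading:
  fixes t w :: "nat \<Rightarrow> real"
  assumes t0: "\<And>i. i < p \<Longrightarrow> 0 \<le> t i"
    and anti: "\<And>i j. i \<le> j \<Longrightarrow> j < p \<Longrightarrow> t j \<le> t i"
    and w: "\<And>i. i < p \<Longrightarrow> 0 \<le> w i" "\<And>i. i < p \<Longrightarrow> w i \<le> 1"
    and sum: "(\<Sum>i<p. w i) \<le> real r" and r: "r \<le> p"
  shows "(\<Sum>i<p. w i * t i) \<le> (\<Sum>i<r. t i)"
proof -
  \<comment> \<open>The threshold is the first value after the leading block. For
    \<open>r = p\<close> there is none, and 0 serves because \<open>t\<close> is
    nonnegative.\<close>
  define l where "l = (if r < p then t r else 0)"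
  have l0: "0 \<le> l" using t0 by (simp add: l_def)
  have sub: "{..<r} = {..<p} \<inter> {i. i < r}" using r by auto
  have "(\<Sum>i<p. w i * t i) \<le> (\<Sum>i<p. (if i < r then t i - l else 0) + l * w i)"
  proof (rule sum_mono)
    fix i assume "i \<in> {..<p}"
    then have i: "i < p" by simp
    show "w i * t i \<le> (if i < r then t i - l else 0) + l * w i"
    proof (cases "i < r")
      case True
      have "l \<le> t i" using True i t0 anti by (auto simp: l_def)
      then have "0 \<le> (1 - w i) * (t i - l)" using w[OF i] by simp
      then show ?thesis using True by (simp add: algebra_simps)
    next
      case False
      have "t i \<le> l" using False i anti by (auto simp: l_def)
      then have "w i * t i \<le> w i * l" using w[OF i] by (simp add: mult_left_mono)
      then show ?thesis using False by (simp add: mult.commute)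
    qed
  qed
  also have "\<dots> = (\<Sum>i<p. if i < r then t i - l else 0) + l * (\<Sum>i<p. w i)"
    by (simp add: sum.distrib sum_distrib_left)
  also have "(\<Sum>i<p. if i < r then t i - l else 0) = (\<Sum>i<r. t i - l)"
    unfolding sub by (subst sum.If_cases) auto
  also have "\<dots> + l * (\<Sum>i<p. w i) = (\<Sum>i<r. t i) - real r * l + l * (\<Sum>i<p. w i)"
    by (simp add: sum_subtractf)
  also have "\<dots> \<le> (\<Sum>i<r. t i)" using mult_left_mono[OF sum l0] by (simp add: mult.commute)
  finally show ?thesis .
qed

text \<open>The sum is a diagonal entry of the projection \<open>?P\<close>. As \<open>?P\<close> is
  symmetric and idempotent, this entry equals the squared norm of its row in \<open>?P\<close>,
  hence is at least its own square.\<close>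

lemma orthonormal_cols_row_le_1:
  assumes "H \<in> orthonormal_cols p m" "i < p"
  shows "(\<Sum>j<m. (H $$ (i, j))\<^sup>2) \<le> 1"
proof -
  note H = orthonormal_colsD[OF assms(1)]
  let ?P = "proj_mat H"
  have P: "?P \<in> carrier_mat p p" using proj_mat_carrier H by blast
  have w: "?P $$ (i, i) = (\<Sum>j<m. (H $$ (i, j))\<^sup>2)"
    using H(1) assms(2)
    by (simp add: proj_mat_def scalar_prod_def power2_eq_square lessThan_atLeast0)
  have sym: "?P $$ (l, i) = ?P $$ (i, l)" if "l < p" for l
    using arg_cong[OF transpose_proj_mat[of H], of "\<lambda>M. M $$ (i, l)"] P that assms(2) by simp
  have "?P $$ (i, i) = (?P * ?P) $$ (i, i)" using proj_mat_idem[OF assms(1)] by simp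
  also have "\<dots> = (\<Sum>l<p. ?P $$ (i, l) * ?P $$ (l, i))"
    using P assms(2) by (simp add: scalar_prod_def lessThan_atLeast0)
  also have "\<dots> = (\<Sum>l<p. (?P $$ (i, l))\<^sup>2)"
    using sym by (intro sum.cong) (auto simp: power2_eq_square)
  finally have "(?P $$ (i, i))\<^sup>2 \<le> ?P $$ (i, i)"
    using member_le_sum[of i "{..<p}" "\<lambda>l. (?P $$ (i, l))\<^sup>2"] assms(2) by simp
  then have "?P $$ (i, i) \<le> 1"
    using mult_strict_right_mono[of 1 "?P $$ (i, i)" "?P $$ (i, i)"]
    by (cases "1 < ?P $$ (i, i)") (auto simp: power2_eq_square)
  then show ?thesis using w by simp
qed

text \<open>In the basis \<open>Q\<close> of left singular vectors both sides are weighted sums of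
  squared singular values. For \<open>U\<close> the weights are squared row norms of
  \<open>H\<close>, at most 1 each and \<open>m\<close> in total; for \<open>W\<close> they are 1 on
  the first \<open>r\<close> indices and 0 elsewhere.\<close>

lemma ky_fan:
  assumes svd: "is_SVD_left r D W" and U: "U \<in> orthonormal_cols (dim_row D) m" and mr: "m \<le> r"
  shows "fro_sq (transpose_mat U * D) \<le> fro_sq (transpose_mat W * D)"
proof -
  obtain Q s V where r: "r \<le> dim_row D" and qsv: "is_SVD D Q s V"
    and W: "W = mat (dim_row D) r (\<lambda>(i, j). Q $$ (i, j))"
    using svd by (auto simp: is_SVD_left_def)
  define p n where "p = dim_row D" and "n = dim_col D"
  define S where "S = mat p n (\<lambda>(i, j). if i = j then s i else 0)"
  have Q: "Q \<in> orthonormal_cols p p" and V: "V \<in> orthonormal_cols n n"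
    and s0: "\<And>i. i < min p n \<Longrightarrow> 0 \<le> s i"
    and anti: "\<And>i j. i \<le> j \<Longrightarrow> j < min p n \<Longrightarrow> s j \<le> s i"
    and D: "D = Q * S * transpose_mat V"
    using qsv unfolding is_SVD_def p_def n_def S_def by auto
  note Qc = orthonormal_colsD[OF Q] and Vc = orthonormal_colsD[OF V]
  have Sc: "S \<in> carrier_mat p n" by (simp add: S_def)
  have QQ: "Q * transpose_mat Q = 1\<^sub>m p"
    using mat_mult_left_right_inverse[of "transpose_mat Q" p Q] Qc by simp
  \<comment> \<open>Squared singular values, padded with 0 for row indices beyond the number of
    columns.\<close>
  define t where "t i = (if i < n then (s i)\<^sup>2 else 0)" for i
  have fro: "fro_sq (transpose_mat X * D) = (\<Sum>j<l. \<Sum>i<p. ((transpose_mat X * Q) $$ (j, i))\<^sup>2 * t i)"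
    if X: "X \<in> carrier_mat p l" for X l
  proof -
    define C where "C = transpose_mat X * Q"
    have C: "C \<in> carrier_mat l p" using X Qc by (simp add: C_def)
    have "transpose_mat X * D = transpose_mat X * (Q * S) * transpose_mat V"
      unfolding D using X Qc Vc Sc by (subst assoc_mult_mat[of _ l p _ n _ n]) auto
    also have "transpose_mat X * (Q * S) = C * S"
      unfolding C_def using X Qc Sc by (subst assoc_mult_mat[of _ l p _ p _ n]) auto
    finally have "fro_sq (transpose_mat X * D) = fro_sq (C * S)"
      using fro_sq_mult_orthogonal[OF _ V, of "C * S" l] C Sc by simp
    also have "\<dots> = (\<Sum>j<l. \<Sum>i<p. (C $$ (j, i))\<^sup>2 * t i)"
      unfolding fro_sq_def
    proof (rule sum.cong)
      fix j assume "j \<in> {..<l}"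
      then have j: "j < l" by simp
      have cs: "(C * S) $$ (j, i) = (if i < p then C $$ (j, i) * s i else 0)" if "i < n" for i
      proof -
        have "(C * S) $$ (j, i) = (\<Sum>a<p. C $$ (j, a) * (if a = i then s a else 0))"
          using C that j by (simp add: S_def scalar_prod_def lessThan_atLeast0)
        also have "\<dots> = (\<Sum>a<p. if a = i then C $$ (j, i) * s i else 0)"
          by (intro sum.cong) auto
        finally show ?thesis by simp
      qed
      have "(\<Sum>i<n. ((C * S) $$ (j, i))\<^sup>2) = (\<Sum>i<n. if i < p then (C $$ (j, i))\<^sup>2 * (s i)\<^sup>2 else 0)"
        using cs by (intro sum.cong) (auto simp: power_mult_distrib)
      also have "\<dots> = (\<Sum>i\<in>{..<n} \<inter> {..<p}. (C $$ (j, i))\<^sup>2 * (s i)\<^sup>2)"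
        by (subst sum.inter_restrict) auto
      also have "{..<n} \<inter> {..<p} = {..<p} \<inter> {..<n}" by auto
      also have "(\<Sum>i\<in>{..<p} \<inter> {..<n}. (C $$ (j, i))\<^sup>2 * (s i)\<^sup>2) = (\<Sum>i<p. (C $$ (j, i))\<^sup>2 * t i)"
        by (subst sum.inter_restrict) (auto simp: t_def intro!: sum.cong)
      finally show "(\<Sum>i<dim_col (C * S). ((C * S) $$ (j, i))\<^sup>2) = (\<Sum>i<p. (C $$ (j, i))\<^sup>2 * t i)"
        using Sc by simp
    qed (use C in auto)
    finally show ?thesis by (simp add: C_def)
  qed
  have rp: "r \<le> p" using r by (simp add: p_def)
  have Wc: "W \<in> carrier_mat p r" by (simp add: W p_def)
  have fW: "fro_sq (transpose_mat W * D) = (\<Sum>i<r. t i)"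
  proof -
    have "(transpose_mat W * Q) $$ (j, i) = (if j = i then 1 else 0)" if "j < r" "i < p" for j i
    proof -
      have "(transpose_mat W * Q) $$ (j, i) = (transpose_mat Q * Q) $$ (j, i)"
        using that Wc Qc(1) rp by (simp add: scalar_prod_def W p_def)
      then show ?thesis using Qc(2) that rp by simp
    qed
    then have "fro_sq (transpose_mat W * D) = (\<Sum>j<r. \<Sum>i<p. (if j = i then 1 else 0)\<^sup>2 * t i)"
      unfolding fro[OF Wc] by (intro sum.cong) auto
    also have "\<dots> = (\<Sum>j<r. \<Sum>i<p. if j = i then t i else 0)"
      by (intro sum.cong) auto
    also have "\<dots> = (\<Sum>j<r. t j)" using rp by (intro sum.cong) auto
    finally show ?thesis .
  qed
  note Uc = orthonormal_colsD[OF U, folded p_def]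
  define H where "H = transpose_mat Q * U"
  have HT: "transpose_mat H = transpose_mat U * Q"
    unfolding H_def using Uc Qc by (subst transpose_mult[of _ p p _ m]) auto
  have H: "H \<in> orthonormal_cols p m"
  proof -
    have "transpose_mat H * H = transpose_mat U * (Q * (transpose_mat Q * U))"
      unfolding HT unfolding H_def using Uc Qc by (subst assoc_mult_mat[of _ m p _ p _ m]) auto
    also have "Q * (transpose_mat Q * U) = U"
      using Uc Qc QQ by (subst assoc_mult_mat[of _ p p _ p _ m, symmetric]) auto
    finally show ?thesis using Uc Qc by (simp add: orthonormal_cols_def H_def)
  qed
  note Hc = orthonormal_colsD[OF H]
  define w where "w i = (\<Sum>j<m. (H $$ (i, j))\<^sup>2)" for i
  have "fro_sq (transpose_mat U * D) = (\<Sum>j<m. \<Sum>i<p. (H $$ (i, j))\<^sup>2 * t i)"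
    unfolding fro[OF Uc(1)] HT[symmetric] using Hc(1) by (intro sum.cong) auto
  also have "\<dots> = (\<Sum>i<p. w i * t i)"
    unfolding w_def by (subst sum.swap) (simp add: sum_distrib_right)
  also have "\<dots> \<le> (\<Sum>i<r. t i)"
  proof (rule sum_weights_le_leading)
    show "(\<Sum>i<p. w i) \<le> real r"
    proof -
      \<comment> \<open>After exchanging the sums the total weight is the trace of the identity of
        size \<open>m\<close>.\<close>
      have "(\<Sum>i<p. w i) = (\<Sum>j<m. \<Sum>i<p. (H $$ (i, j))\<^sup>2)"
        unfolding w_def by (rule sum.swap)
      also have "\<dots> = (\<Sum>j<m. (transpose_mat H * H) $$ (j, j))"
        using Hc(1) by (intro sum.cong) (auto simp: scalar_prod_def power2_eq_square lessThan_atLeast0)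
      also have "\<dots> = m" using Hc(2) by simp
      finally show ?thesis using mr by simp
    qed
    show "w i \<le> 1" if "i < p" for i
      unfolding w_def by (rule orthonormal_cols_row_le_1[OF H that])
    show "t j \<le> t i" if "i \<le> j" "j < p" for i j
      using that anti[of i j] s0[of j] by (auto simp: t_def power_mono)
  qed (use rp in \<open>auto simp: w_def t_def sum_nonneg\<close>)
  finally show ?thesis unfolding fW .
qed

lemma is_SVD_left_orthonormal:
  assumes "is_SVD_left r D W"
  shows "W \<in> orthonormal_cols (dim_row D) r"
proof -
  obtain Q s V where r: "r \<le> dim_row D" and Q: "Q \<in> orthonormal_cols (dim_row D) (dim_row D)"
    and W: "W = mat (dim_row D) r (\<lambda>(i, j). Q $$ (i, j))"
    using assms by (auto simp: is_SVD_left_def is_SVD_def)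
  note Qc = orthonormal_colsD[OF Q]
  have "transpose_mat W * W = 1\<^sub>m r"
  proof (rule eq_matI)
    fix i j assume "i < dim_row (1\<^sub>m r :: real mat)" "j < dim_col (1\<^sub>m r :: real mat)"
    then have ij: "i < r" "j < r" by auto
    then have "(transpose_mat W * W) $$ (i, j) = (transpose_mat Q * Q) $$ (i, j)"
      using r Qc(1) by (simp add: W scalar_prod_def)
    then show "(transpose_mat W * W) $$ (i, j) = 1\<^sub>m r $$ (i, j)" using Qc(2) ij r by simp
  qed (auto simp: W)
  then show ?thesis by (simp add: orthonormal_cols_def W)
qed

text \<open>Both sides are the orthogonal projection onto the sum of the two column spaces.\<close>

lemma proj_mat_sum_exchange:
  assumes Q: "Q \<in> orthonormal_cols p r" and U: "U \<in> orthonormal_cols p m"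
  obtains W m' V r' where "m' \<le> m" "W \<in> orthonormal_cols p m'" "r' \<le> r" "V \<in> orthonormal_cols p r'"
    "transpose_mat U * V = 0\<^sub>m m r'"
    "(1\<^sub>m p - proj_mat Q) * U = proj_mat W * U"
    "proj_mat Q + proj_mat W = proj_mat U + proj_mat V"
proof -
  note Qc = orthonormal_colsD[OF Q] and Uc = orthonormal_colsD[OF U]
  \<comment> \<open>Used twice, with \<open>Q\<close> and \<open>U\<close> in both orders. The last
    clause says that the columns of \<open>W\<close> lie in the joint span of \<open>Q\<close> and
    \<open>U\<close>.\<close>
  have half: "\<exists>W m'. m' \<le> m \<and> W \<in> orthonormal_cols p m' \<and> transpose_mat Q * W = 0\<^sub>m r m' \<and>
     (1\<^sub>m p - proj_mat Q) * U = proj_mat W * U \<and>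
     (\<forall>K. K \<in> carrier_mat p p \<longrightarrow> K * Q = 0\<^sub>m p r \<longrightarrow> K * U = 0\<^sub>m p m \<longrightarrow> K * W = 0\<^sub>m p m')"
    if Q: "Q \<in> orthonormal_cols p r" and U: "U \<in> orthonormal_cols p m" for Q U r m
  proof -
    note Qc = orthonormal_colsD[OF Q] and Uc = orthonormal_colsD[OF U]
    note PQ = proj_mat_carrier[OF Qc(1)]
    let ?M = "(1\<^sub>m p - proj_mat Q) * U"
    have M: "?M \<in> carrier_mat p m" using PQ Uc by auto
    obtain W m' where W: "m' \<le> m" "W \<in> orthonormal_cols p m'" "proj_mat W * ?M = ?M"
      and K: "\<And>K l. K \<in> carrier_mat l p \<Longrightarrow> K * ?M = 0\<^sub>m l m \<Longrightarrow> K * W = 0\<^sub>m l m'"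
      by (rule orthonormal_range_basis[OF M]) (rule that, assumption+)
    note Wc = orthonormal_colsD[OF W(2)]
    note PW = proj_mat_carrier[OF Wc(1)]
    have M': "?M = U - Q * (transpose_mat Q * U)"
      using Qc Uc PQ unfolding proj_mat_def
      by (subst minus_mult_distrib_mat[of _ p p]) (auto simp: assoc_mult_mat[of _ p r _ p _ m])
    \<comment> \<open>Whatever annihilates both \<open>Q\<close> and \<open>U\<close> therefore
      annihilates \<open>?M\<close>; and the transpose of \<open>Q\<close> annihilates
      \<open>?M\<close> because the two terms cancel.\<close>
    have KM: "L * ?M = L * U - L * Q * (transpose_mat Q * U)" if "L \<in> carrier_mat l p" for L l
      unfolding M' using that Qc Uc
      by (subst mult_minus_distrib_mat[of _ l p]) (auto simp: assoc_mult_mat[of _ l p _ r _ m])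
    have QW: "transpose_mat Q * W = 0\<^sub>m r m'"
      using Qc Uc by (intro K) (auto simp: KM[of _ r])
    have WQ: "transpose_mat W * Q = 0\<^sub>m m' r"
      using arg_cong[OF QW, of transpose_mat] Qc Wc by (subst (asm) transpose_mult[of _ r p _ m']) auto
    have "proj_mat W * ?M = proj_mat W * U"
    proof -
      have "proj_mat W * Q = W * (transpose_mat W * Q)"
        unfolding proj_mat_def using Wc Qc by (subst assoc_mult_mat[of _ p m' _ p _ r]) auto
      then have "proj_mat W * Q = 0\<^sub>m p r" using WQ Wc by simp
      moreover have "proj_mat W * U - 0\<^sub>m p m = proj_mat W * U"
        using PW Uc by (intro eq_matI) auto
      ultimately show ?thesis unfolding KM[OF PW] using PW Uc Qc by simp
    qed
    then have 1: "?M = proj_mat W * U" using W(3) by simp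
    have 2: "L * W = 0\<^sub>m p m'" if "L \<in> carrier_mat p p" "L * Q = 0\<^sub>m p r" "L * U = 0\<^sub>m p m" for L
      using that Qc Uc by (intro K) (auto simp: KM[OF that(1)])
    show ?thesis using W QW 1 2 by blast
  qed
  \<comment> \<open>The sum of the two projections fixes \<open>Q\<close> by orthogonality, and
    \<open>U\<close> because \<open>proj_mat W\<close> restores exactly what
    \<open>proj_mat Q\<close> loses of it.\<close>
  have fixes': "(proj_mat Q + proj_mat W) * Q = Q \<and> (proj_mat Q + proj_mat W) * U = U"
    if Q: "Q \<in> orthonormal_cols p r" and U: "U \<in> orthonormal_cols p m" and W: "W \<in> orthonormal_cols p m'"
      and QW: "transpose_mat Q * W = 0\<^sub>m r m'" and eq: "(1\<^sub>m p - proj_mat Q) * U = proj_mat W * U"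
    for Q U W r m m'
  proof -
    note Qc = orthonormal_colsD[OF Q] and Uc = orthonormal_colsD[OF U] and Wc = orthonormal_colsD[OF W]
    note PQ = proj_mat_carrier[OF Qc(1)] and PW = proj_mat_carrier[OF Wc(1)]
    have WQ: "transpose_mat W * Q = 0\<^sub>m m' r"
      using arg_cong[OF QW, of transpose_mat] Qc Wc by (subst (asm) transpose_mult[of _ r p _ m']) auto
    have "proj_mat W * Q = W * (transpose_mat W * Q)"
      unfolding proj_mat_def using Wc Qc by (subst assoc_mult_mat[of _ p m' _ p _ r]) auto
    then have "proj_mat W * Q = 0\<^sub>m p r" using WQ Wc by simp
    then have 1: "(proj_mat Q + proj_mat W) * Q = Q"
      using PQ PW Qc proj_mat_mult_self(1)[OF Q] by (subst add_mult_distrib_mat[of _ p p]) auto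
    have "U - proj_mat Q * U = proj_mat W * U"
      using eq PQ Uc by (subst (asm) minus_mult_distrib_mat[of _ p p]) auto
    then have "proj_mat Q * U + proj_mat W * U = proj_mat Q * U + (U - proj_mat Q * U)" by simp
    also have "\<dots> = U" using PQ Uc by (auto intro!: eq_matI)
    finally have "(proj_mat Q + proj_mat W) * U = U"
      using PQ PW Uc by (subst add_mult_distrib_mat[of _ p p]) auto
    then show ?thesis using 1 by simp
  qed
  obtain W m' where W: "m' \<le> m" "W \<in> orthonormal_cols p m'" "transpose_mat Q * W = 0\<^sub>m r m'"
     "(1\<^sub>m p - proj_mat Q) * U = proj_mat W * U"
     and KW: "\<And>K. K \<in> carrier_mat p p \<Longrightarrow> K * Q = 0\<^sub>m p r \<Longrightarrow> K * U = 0\<^sub>m p m \<Longrightarrow> K * W = 0\<^sub>m p m'"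
    using half[OF Q U] by blast
  obtain V r' where V: "r' \<le> r" "V \<in> orthonormal_cols p r'" "transpose_mat U * V = 0\<^sub>m m r'"
     "(1\<^sub>m p - proj_mat U) * Q = proj_mat V * Q"
     and KV: "\<And>K. K \<in> carrier_mat p p \<Longrightarrow> K * U = 0\<^sub>m p m \<Longrightarrow> K * Q = 0\<^sub>m p r \<Longrightarrow> K * V = 0\<^sub>m p r'"
    using half[OF U Q] by blast
  note Wc = orthonormal_colsD[OF W(2)] and Vc = orthonormal_colsD[OF V(2)]
  note P = proj_mat_carrier[OF Qc(1)] proj_mat_carrier[OF Uc(1)] proj_mat_carrier[OF Wc(1)]
    proj_mat_carrier[OF Vc(1)]
  define P1 P2 where "P1 = proj_mat Q + proj_mat W" and "P2 = proj_mat U + proj_mat V"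
  have Pc: "P1 \<in> carrier_mat p p" "P2 \<in> carrier_mat p p" using P by (auto simp: P1_def P2_def)
  have f1: "P1 * Q = Q" "P1 * U = U" using fixes'[OF Q U W(2-4)] by (auto simp: P1_def)
  have f2: "P2 * U = U" "P2 * Q = Q" using fixes'[OF U Q V(2-4)] by (auto simp: P2_def)
  have compl: "(1\<^sub>m p - L) * X = 0\<^sub>m p n \<longleftrightarrow> L * X = X"
    if "L \<in> carrier_mat p p" "X \<in> carrier_mat p n" for L X :: "real mat" and n
    using that by (subst minus_mult_distrib_mat[of _ p p]) (auto simp: mat_eq_iff)
  \<comment> \<open>The complement of \<open>P1\<close> annihilates \<open>Q\<close> and
    \<open>U\<close>, hence their joint span, in which the columns of \<open>V\<close> lie.\<close>
  have f1': "P1 * V = V"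
    using KV[of "1\<^sub>m p - P1"] f1 Pc Qc Uc Vc by (simp add: compl minus_carrier_mat)
  have f2': "P2 * W = W"
    using KW[of "1\<^sub>m p - P2"] f2 Pc Qc Uc Wc by (simp add: compl minus_carrier_mat)
  have absorb: "L * proj_mat X = proj_mat X"
    if "L * X = X" "L \<in> carrier_mat p p" "X \<in> carrier_mat p n" for L X n
    unfolding proj_mat_def using that
    by (subst assoc_mult_mat[of _ p p _ n _ p, symmetric]) auto
  have P12: "P1 * P2 = P2" unfolding P2_def
    using Pc P absorb[OF f1(2) Pc(1) Uc(1)] absorb[OF f1' Pc(1) Vc(1)]
    by (subst mult_add_distrib_mat[of _ p p]) auto
  have P21: "P2 * P1 = P1" unfolding P1_def
    using Pc P absorb[OF f2(2) Pc(2) Qc(1)] absorb[OF f2' Pc(2) Wc(1)]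
    by (subst mult_add_distrib_mat[of _ p p]) auto
  have sym: "transpose_mat P1 = P1" "transpose_mat P2 = P2"
    unfolding P1_def P2_def using P by (auto simp: transpose_add[of _ p p] transpose_proj_mat)
  \<comment> \<open>Each of \<open>P1\<close> and \<open>P2\<close> fixes the range of the other;
    transposing \<open>P1 * P2 = P2\<close> reverses the factors and forces equality.\<close>
  have "P2 = transpose_mat (P1 * P2)" using P12 sym by simp
  also have "\<dots> = P2 * P1" using Pc sym by (subst transpose_mult[of _ p p _ p]) auto
  finally have "P1 = P2" using P21 by simp
  then show thesis using that W V by (simp add: P1_def P2_def)
qed

section \<open>Mode products and the Frobenius inner product\<close>

text \<open>Index set of the mode-\<open>k\<close> fibres. The members are undefined at
  \<open>k\<close>, and \<open>i(k := a)\<close> runs along the fibre of \<open>i\<close>.\<close>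

definition fibers :: "nat \<Rightarrow> (nat \<Rightarrow> nat) \<Rightarrow> nat \<Rightarrow> (nat \<Rightarrow> nat) set" where
  "fibers d p k = (\<Pi>\<^sub>E l\<in>{..<d} - {k}. {..<p l})"

lemma fibers_upd: "fibers d (p(k := m)) k = fibers d p k"
  unfolding fibers_def by (rule PiE_cong) auto

text \<open>Dimension functions matter only below \<open>d\<close>; those obtained by different
  sequences of compressions agree only there.\<close>

lemma multi_indices_cong: "(\<And>j. j < d \<Longrightarrow> p j = q j) \<Longrightarrow> multi_indices d p = multi_indices d q"
  unfolding multi_indices_def by (rule PiE_cong) auto

lemma tensors_cong: "(\<And>j. j < d \<Longrightarrow> p j = q j) \<Longrightarrow> tensors d p = tensors d q"
  unfolding tensors_def using multi_indices_cong[of d p q] by simp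

lemma fro_norm_cong: "(\<And>j. j < d \<Longrightarrow> p j = q j) \<Longrightarrow> fro_norm d p X = fro_norm d q X"
  unfolding fro_norm_def using multi_indices_cong[of d p q] by simp

text \<open>Reduces identities and estimates that concern a single mode to single fibres.\<close>

lemma sum_multi_indices_fibers:
  assumes "k < d"
  shows "(\<Sum>i\<in>multi_indices d p. f i) = (\<Sum>i\<in>fibers d p k. \<Sum>a<p k. f (i(k := a)))"
proof -
  have ins: "{..<d} = insert k ({..<d} - {k})" using assms by auto
  have "multi_indices d p = (\<lambda>(a, i). i(k := a)) ` ({..<p k} \<times> fibers d p k)"
    unfolding multi_indices_def fibers_def by (subst ins) (simp only: PiE_insert_eq)
  moreover have "inj_on (\<lambda>(a, i). i(k := a)) ({..<p k} \<times> fibers d p k)"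
    unfolding fibers_def using inj_combinator[of k "{..<d} - {k}" "\<lambda>l. {..<p l}"] by simp
  ultimately have "(\<Sum>i\<in>multi_indices d p. f i) = (\<Sum>(a, i)\<in>{..<p k} \<times> fibers d p k. f (i(k := a)))"
    by (simp add: sum.reindex case_prod_unfold)
  also have "\<dots> = (\<Sum>a<p k. \<Sum>i\<in>fibers d p k. f (i(k := a)))"
    by (simp add: sum.cartesian_product)
  also have "\<dots> = (\<Sum>i\<in>fibers d p k. \<Sum>a<p k. f (i(k := a)))"
    by (rule sum.swap)
  finally show ?thesis .
qed

definition tensor_inner :: "nat \<Rightarrow> (nat \<Rightarrow> nat) \<Rightarrow> tensor \<Rightarrow> tensor \<Rightarrow> real" where
  "tensor_inner d p X Y = (\<Sum>i\<in>multi_indices d p. X i * Y i)"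

lemma tensor_inner_cong: "(\<And>j. j < d \<Longrightarrow> p j = q j) \<Longrightarrow> tensor_inner d p X Y = tensor_inner d q X Y"
  unfolding tensor_inner_def using multi_indices_cong[of d p q] by simp

lemma fro_norm_L2: "fro_norm d p X = L2_set X (multi_indices d p)"
  by (simp add: fro_norm_def L2_set_def)

lemma fro_norm_nonneg [simp]: "0 \<le> fro_norm d p X"
  by (simp add: fro_norm_L2)

lemma fro_norm_sq: "(fro_norm d p X)\<^sup>2 = tensor_inner d p X X"
  by (simp add: fro_norm_def tensor_inner_def sum_nonneg power2_eq_square[symmetric])

lemma fro_norm_uminus: "fro_norm d p (tensor_diff X Y) = fro_norm d p (tensor_diff Y X)"
  by (simp add: fro_norm_def tensor_diff_def power2_commute)

lemma fro_norm_diff_triangle: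
  "fro_norm d p (tensor_diff X Z) \<le> fro_norm d p (tensor_diff X Y) + fro_norm d p (tensor_diff Y Z)"
  using L2_set_triangle_ineq[of "tensor_diff X Y" "tensor_diff Y Z" "multi_indices d p"]
  by (simp add: fro_norm_L2 tensor_diff_def)

lemma fro_norm_diff_le: "fro_norm d p (tensor_diff X Y) \<le> fro_norm d p X + fro_norm d p Y"
  using fro_norm_diff_triangle[of d p X Y "\<lambda>_. 0"] fro_norm_uminus[of d p "\<lambda>_. 0" Y]
    fro_norm_diff_triangle[of d p X "\<lambda>_. 0" Y]
  by (simp add: tensor_diff_def fro_norm_def)

lemma tensor_inner_le: "tensor_inner d p X Y \<le> fro_norm d p X * fro_norm d p Y"
proof -
  have "tensor_inner d p X Y \<le> (\<Sum>i\<in>multi_indices d p. \<bar>X i\<bar> * \<bar>Y i\<bar>)"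
    unfolding tensor_inner_def by (intro sum_mono) (metis abs_ge_self abs_mult)
  also have "\<dots> \<le> fro_norm d p X * fro_norm d p Y"
    unfolding fro_norm_L2 by (rule L2_set_mult_ineq)
  finally show ?thesis .
qed

lemma mode_prod_fiber:
  "mode_prod k A X (i(k := a)) = (if a < dim_row A then \<Sum>b<dim_col A. A $$ (a, b) * X (i(k := b)) else 0)"
  by (simp add: mode_prod_def)

lemma mode_prod_tensors:
  assumes X: "X \<in> tensors d p" and A: "A \<in> carrier_mat m (p k)" and k: "k < d"
  shows "mode_prod k A X \<in> tensors d (p(k := m))"
  unfolding tensors_def mem_Collect_eq
proof (intro allI impI)
  fix i assume i: "i \<notin> multi_indices d (p(k := m))"
  show "mode_prod k A X i = 0"
  proof (cases "i k < m")
    case True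
    have "X (i(k := a)) = 0" if "a < p k" for a
    proof -
      have "i(k := a) \<notin> multi_indices d p"
      proof
        assume "i(k := a) \<in> multi_indices d p"
        then have "i \<in> multi_indices d (p(k := m))"
          using True k unfolding multi_indices_def PiE_iff extensional_def
          by (auto split: if_splits)
        then show False using i by simp
      qed
      then show ?thesis using X by (simp add: tensors_def)
    qed
    then show ?thesis using A by (simp add: mode_prod_def)
  qed (use A in \<open>simp add: mode_prod_def\<close>)
qed

lemma mode_prod_mult:
  assumes "A \<in> carrier_mat l m" "B \<in> carrier_mat m n"
  shows "mode_prod k A (mode_prod k B X) = mode_prod k (A * B) X"
proof
  fix i
  show "mode_prod k A (mode_prod k B X) i = mode_prod k (A * B) X i"
  proof (cases "i k < l")
    case True
    have "mode_prod k A (mode_prod k B X) i = (\<Sum>a<m. A $$ (i k, a) * (\<Sum>b<n. B $$ (a, b) * X (i(k := b))))"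
      using True assms by (simp add: mode_prod_def)
    also have "\<dots> = (\<Sum>b<n. (\<Sum>a<m. A $$ (i k, a) * B $$ (a, b)) * X (i(k := b)))"
      unfolding sum_distrib_left sum_distrib_right by (subst sum.swap) (simp add: mult.assoc)
    also have "\<dots> = mode_prod k (A * B) X i"
      using True assms by (simp add: mode_prod_def scalar_prod_def lessThan_atLeast0)
    finally show ?thesis .
  qed (use assms in \<open>simp add: mode_prod_def\<close>)
qed

lemma mode_prod_commute:
  assumes "k \<noteq> l"
  shows "mode_prod k A (mode_prod l B X) = mode_prod l B (mode_prod k A X)"
proof
  fix i
  have "(\<Sum>a<dim_col A. A $$ (i k, a) * (\<Sum>b<dim_col B. B $$ (i l, b) * X (i(k := a, l := b))))
      = (\<Sum>b<dim_col B. B $$ (i l, b) * (\<Sum>a<dim_col A. A $$ (i k, a) * X (i(l := b, k := a))))"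
    unfolding sum_distrib_left using assms
    by (subst sum.swap) (simp add: mult.left_commute fun_upd_twist)
  then show "mode_prod k A (mode_prod l B X) i = mode_prod l B (mode_prod k A X) i"
    using assms by (auto simp: mode_prod_def)
qed

lemma mode_prod_diff:
  "mode_prod k A (tensor_diff X Y) = tensor_diff (mode_prod k A X) (mode_prod k A Y)"
  by (auto simp: fun_eq_iff mode_prod_def tensor_diff_def sum_subtractf right_diff_distrib)

lemma mode_prod_add_mat:
  assumes "A \<in> carrier_mat m n" "B \<in> carrier_mat m n"
  shows "mode_prod k (A + B) X i = mode_prod k A X i + mode_prod k B X i"
  using assms by (simp add: mode_prod_def sum.distrib distrib_right)

lemma mode_prod_minus_mat:
  assumes "A \<in> carrier_mat m n" "B \<in> carrier_mat m n"
  shows "mode_prod k (A - B) X = tensor_diff (mode_prod k A X) (mode_prod k B X)"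
proof
  fix i
  show "mode_prod k (A - B) X i = tensor_diff (mode_prod k A X) (mode_prod k B X) i"
    using assms by (simp add: mode_prod_def tensor_diff_def sum_subtractf left_diff_distrib)
qed

lemma mode_prod_zero_mat: "mode_prod k (0\<^sub>m m n) X = (\<lambda>_. 0)"
  by (simp add: mode_prod_def fun_eq_iff)

lemma mode_prod_one:
  assumes "X \<in> tensors d p" "k < d"
  shows "mode_prod k (1\<^sub>m (p k)) X = X"
proof
  fix i
  show "mode_prod k (1\<^sub>m (p k)) X i = X i"
  proof (cases "i k < p k")
    case True
    have "mode_prod k (1\<^sub>m (p k)) X i = (\<Sum>a<p k. (if i k = a then 1 else 0) * X (i(k := a)))"
      using True by (simp add: mode_prod_def)
    also have "\<dots> = (\<Sum>a<p k. if a = i k then X i else 0)"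
      by (rule sum.cong) auto
    finally show ?thesis using True by simp
  next
    case False
    \<comment> \<open>Outside the range of mode \<open>k\<close> both sides are 0, the right one
      because \<open>X\<close> vanishes off its index set.\<close>
    then have "i \<notin> multi_indices d p" using assms(2) by (auto simp: multi_indices_def PiE_iff)
    then show ?thesis using False assms(1) by (simp add: mode_prod_def tensors_def)
  qed
qed

text \<open>On each fibre this is the transposition rule for matrices. The inner products refer to
  different dimensions, since \<open>A\<close> changes the size of mode \<open>k\<close> from
  \<open>p k\<close> to \<open>m\<close>.\<close>

lemma tensor_inner_mode_prod:
  assumes A: "A \<in> carrier_mat m (p k)" and k: "k < d"
  shows "tensor_inner d (p(k := m)) (mode_prod k A X) Y = tensor_inner d p X (mode_prod k (transpose_mat A) Y)"
proof -
  have "(\<Sum>a<m. (\<Sum>b<p k. A $$ (a, b) * X (i(k := b))) * Y (i(k := a)))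
      = (\<Sum>b<p k. X (i(k := b)) * (\<Sum>a<m. A $$ (a, b) * Y (i(k := a))))" for i
    unfolding sum_distrib_left sum_distrib_right by (subst sum.swap) (simp add: mult_ac)
  then show ?thesis using A
    unfolding tensor_inner_def sum_multi_indices_fibers[OF k]
    by (simp add: fibers_upd mode_prod_fiber cong: sum.cong_simp)
qed

lemma fro_norm_isometry:
  assumes X: "X \<in> tensors d p" and U: "U \<in> orthonormal_cols m (p k)" and k: "k < d"
  shows "fro_norm d (p(k := m)) (mode_prod k U X) = fro_norm d p X"
proof -
  note Uc = orthonormal_colsD[OF U]
  have "(fro_norm d (p(k := m)) (mode_prod k U X))\<^sup>2 = (fro_norm d p X)\<^sup>2"
    unfolding fro_norm_sq using Uc mode_prod_one[OF X k]
    by (subst tensor_inner_mode_prod[of U m p k d, OF Uc(1) k]) (simp add: mode_prod_mult[of _ "p k" m])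
  then show ?thesis by simp
qed

context
  fixes d p k m U
  assumes k: "k < (d :: nat)" and U: "U \<in> orthonormal_cols (p k) m"
begin

lemma tensor_inner_proj:
  "tensor_inner d p (mode_prod k (proj_mat U) X) Y = tensor_inner d p X (mode_prod k (proj_mat U) Y)"
  using tensor_inner_mode_prod[of "proj_mat U" "p k" p k d X Y,
    OF proj_mat_carrier[OF orthonormal_colsD(1)[OF U]] k]
  by (simp only: fun_upd_triv transpose_proj_mat)

lemma mode_prod_proj_idem:
  "mode_prod k (proj_mat U) (mode_prod k (proj_mat U) X) = mode_prod k (proj_mat U) X"
  using proj_mat_idem[OF U] proj_mat_carrier[OF orthonormal_colsD(1)[OF U]]
  by (simp add: mode_prod_mult[of _ "p k" "p k"])

lemma fro_norm_proj_sq: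
  "(fro_norm d p (mode_prod k (proj_mat U) X))\<^sup>2 = tensor_inner d p X (mode_prod k (proj_mat U) X)"
  unfolding fro_norm_sq tensor_inner_proj[of X] mode_prod_proj_idem ..

text \<open>Trades a projection for a compression, whose matricization is the matrix product to
  which Ky Fan's inequality applies.\<close>

lemma fro_norm_proj_sq_compressed:
  "(fro_norm d p (mode_prod k (proj_mat U) X))\<^sup>2
    = (fro_norm d (p(k := m)) (mode_prod k (transpose_mat U) X))\<^sup>2"
proof -
  have Uc: "transpose_mat U \<in> carrier_mat m (p k)" using orthonormal_colsD(1)[OF U] by simp
  show ?thesis unfolding fro_norm_proj_sq
    by (subst fro_norm_sq) (subst tensor_inner_mode_prod[of "transpose_mat U" m p k d, OF Uc k],
      use Uc in \<open>simp add: mode_prod_mult[of U "p k" m] proj_mat_def\<close>)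
qed

lemma fro_norm_proj_le: "fro_norm d p (mode_prod k (proj_mat U) X) \<le> fro_norm d p X"
proof -
  let ?n = "fro_norm d p (mode_prod k (proj_mat U) X)"
  \<comment> \<open>The square on the left is an inner product with \<open>X\<close>, so this is
    Cauchy-Schwarz; one factor \<open>?n\<close> then cancels unless it is 0.\<close>
  have "?n * ?n \<le> fro_norm d p X * ?n"
    using fro_norm_proj_sq[of X] tensor_inner_le[of d p X "mode_prod k (proj_mat U) X"]
    by (simp add: power2_eq_square)
  then show ?thesis
    by (metis fro_norm_nonneg mult_le_cancel_right order_le_less)
qed

end

section \<open>Products over several modes\<close>

lemma mode_prods_simps [simp]:
  "mode_prods [] A X = X"
  "mode_prods (k # ks) A X = mode_prods ks A (mode_prod k (A k) X)"
  "mode_prods (ks @ ls) A X = mode_prods ls A (mode_prods ks A X)"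
  by (simp_all add: mode_prods_def)

lemma mode_prods_commute:
  "k \<notin> set ks \<Longrightarrow> mode_prods ks A (mode_prod k B X) = mode_prod k B (mode_prods ks A X)"
proof (induction ks arbitrary: X)
  case (Cons a ks)
  then show ?case using mode_prod_commute[of a k "A a" B X] by simp
qed simp

lemma mode_prods_diff:
  "mode_prods ks A (tensor_diff X Y) = tensor_diff (mode_prods ks A X) (mode_prods ks A Y)"
  by (induction ks arbitrary: X Y) (auto simp: mode_prod_diff)

text \<open>Factors in different modes commute, so the last factor in mode \<open>k\<close> can be
  moved outermost, where rank bounds and idempotence act on it.\<close>

lemma mode_prods_factor:
  "k \<in> set ks \<Longrightarrow> \<exists>X'. mode_prods ks A X = mode_prod k (A k) X'"
proof (induction ks rule: rev_induct)
  case (snoc l ks)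
  show ?case
  proof (cases "l = k")
    case False
    then obtain X' where "mode_prods ks A X = mode_prod k (A k) X'" using snoc by auto
    then show ?thesis using mode_prod_commute[OF False] by auto
  qed auto
qed simp

text \<open>Dimension bookkeeping for the inductions over \<open>ks\<close>: changing mode
  \<open>a\<close> first and then those of \<open>ks\<close> amounts to changing all of them at
  once.\<close>

lemma override_on_upd:
  "a \<notin> set ks \<Longrightarrow> override_on (p(a := m a)) m (set ks) = override_on p m (set (a # ks))"
  by (auto simp: override_on_def fun_eq_iff)

lemma mode_prods_tensors:
  assumes "X \<in> tensors d p" "distinct ks" "set ks \<subseteq> {..<d}"
    "\<And>j. j \<in> set ks \<Longrightarrow> A j \<in> carrier_mat (m j) (p j)"
  shows "mode_prods ks A X \<in> tensors d (override_on p m (set ks))"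
  using assms
proof (induction ks arbitrary: X p)
  case (Cons a ks)
  have "mode_prods ks A (mode_prod a (A a) X) \<in> tensors d (override_on (p(a := m a)) m (set ks))"
    using Cons.prems by (intro Cons.IH mode_prod_tensors) auto
  then show ?case using Cons.prems by (simp add: override_on_upd del: list.set(2))
qed simp

text \<open>Passing to the adjoint reverses a composition, hence \<open>rev ks\<close>.\<close>

lemma tensor_inner_mode_prods:
  assumes "distinct ks" "set ks \<subseteq> {..<d}"
    "\<And>j. j \<in> set ks \<Longrightarrow> A j \<in> carrier_mat (m j) (p j)"
  shows "tensor_inner d (override_on p m (set ks)) (mode_prods ks A X) Y
    = tensor_inner d p X (mode_prods (rev ks) (\<lambda>j. transpose_mat (A j)) Y)"
  using assms
proof (induction ks arbitrary: X p)
  case (Cons a ks)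
  have "tensor_inner d (override_on (p(a := m a)) m (set ks)) (mode_prods ks A (mode_prod a (A a) X)) Y
      = tensor_inner d (p(a := m a)) (mode_prod a (A a) X) (mode_prods (rev ks) (\<lambda>j. transpose_mat (A j)) Y)"
    using Cons.prems by (intro Cons.IH) auto
  also have "\<dots> = tensor_inner d p X (mode_prods (rev (a # ks)) (\<lambda>j. transpose_mat (A j)) Y)"
    using Cons.prems by (subst tensor_inner_mode_prod) auto
  finally show ?case using Cons.prems by (simp add: override_on_upd del: list.set(2))
qed simp

lemma fro_norm_mode_prods_isometry:
  assumes "X \<in> tensors d p" "distinct ks" "set ks \<subseteq> {..<d}"
    "\<And>j. j \<in> set ks \<Longrightarrow> U j \<in> orthonormal_cols (m j) (p j)"
  shows "fro_norm d (override_on p m (set ks)) (mode_prods ks U X) = fro_norm d p X"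
  using assms
proof (induction ks arbitrary: X p)
  case (Cons a ks)
  have Ua: "U a \<in> orthonormal_cols (m a) (p a)" using Cons.prems by auto
  have "fro_norm d (override_on (p(a := m a)) m (set ks)) (mode_prods ks U (mode_prod a (U a) X))
      = fro_norm d (p(a := m a)) (mode_prod a (U a) X)"
    using Cons.prems orthonormal_colsD[OF Ua] by (intro Cons.IH mode_prod_tensors) auto
  also have "\<dots> = fro_norm d p X"
    using Cons.prems by (intro fro_norm_isometry) auto
  finally show ?case using Cons.prems by (simp add: override_on_upd del: list.set(2))
qed simp

text \<open>Iterates a one-mode estimate. Being fixed by \<open>P j\<close> survives products in the
  other modes because these commute with it. The estimate is assumed for every \<open>q\<close> that
  agrees with \<open>p\<close> at \<open>j\<close>, since earlier steps have already changed the
  other dimensions.\<close>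

lemma fro_norm_le_mode_prods:
  assumes "X \<in> tensors d p" "distinct ks" "set ks \<subseteq> {..<d}"
    and "\<And>j. j \<in> set ks \<Longrightarrow> A j \<in> carrier_mat (m j) (p j)"
    and "\<And>j. j \<in> set ks \<Longrightarrow> mode_prod j (P j) X = X"
    and bound: "\<And>j q Y. j \<in> set ks \<Longrightarrow> q j = p j \<Longrightarrow> Y \<in> tensors d q \<Longrightarrow> mode_prod j (P j) Y = Y \<Longrightarrow>
      fro_norm d q Y \<le> c * fro_norm d (q(j := m j)) (mode_prod j (A j) Y)"
    and c: "0 \<le> c"
  shows "fro_norm d p X \<le> c ^ length ks * fro_norm d (override_on p m (set ks)) (mode_prods ks A X)"
  using assms(1-6)
proof (induction ks arbitrary: X p)
  case (Cons a ks)
  have "fro_norm d p X \<le> c * fro_norm d (p(a := m a)) (mode_prod a (A a) X)"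
    using Cons.prems by (intro Cons.prems(6)) auto
  also have "fro_norm d (p(a := m a)) (mode_prod a (A a) X) \<le> c ^ length ks *
    fro_norm d (override_on (p(a := m a)) m (set ks)) (mode_prods ks A (mode_prod a (A a) X))"
  proof (rule Cons.IH)
    fix j assume j: "j \<in> set ks"
    then have "j \<noteq> a" using Cons.prems by auto
    then show "mode_prod j (P j) (mode_prod a (A a) X) = mode_prod a (A a) X"
      using Cons.prems(5)[of j] j by (simp add: mode_prod_commute)
  next
    fix j q Y assume *: "j \<in> set ks" "q j = (p(a := m a)) j" "Y \<in> tensors d q" "mode_prod j (P j) Y = Y"
    then have "j \<noteq> a" using Cons.prems by auto
    then show "fro_norm d q Y \<le> c * fro_norm d (q(j := m j)) (mode_prod j (A j) Y)"
      using * by (intro Cons.prems(6)) auto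
  next
    show "mode_prod a (A a) X \<in> tensors d (p(a := m a))"
      using Cons.prems by (intro mode_prod_tensors) auto
  qed (use Cons.prems in auto)
  finally show ?case
    using Cons.prems c by (simp add: override_on_upd mult.assoc mult_left_mono del: list.set(2))
qed simp

section \<open>Matricizations and low Tucker rank\<close>

text \<open>The mixed-radix digits of the column number \<open>c\<close>, with mode \<open>k\<close>
  left out, as in the column order of \<open>matricize\<close>.\<close>

definition fiber_of_column :: "nat \<Rightarrow> (nat \<Rightarrow> nat) \<Rightarrow> nat \<Rightarrow> nat \<Rightarrow> nat \<Rightarrow> nat" where
  "fiber_of_column d p k c = (\<lambda>l\<in>{..<d} - {k}. (c div (\<Prod>m\<in>{..<l} - {k}. p m)) mod p l)"

lemma matricize_index:
  assumes "k < d" "a < p k" "c < (\<Prod>j\<in>{..<d} - {k}. p j)"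
  shows "matricize d p k X $$ (a, c) = X ((fiber_of_column d p k c)(k := a))"
proof -
  have "(\<lambda>l\<in>{..<d}. if l = k then a else (c div (\<Prod>m\<in>{..<l} - {k}. p m)) mod p l)
      = (fiber_of_column d p k c)(k := a)"
    using assms(1) by (auto simp: fun_eq_iff fiber_of_column_def)
  then show ?thesis using assms by (simp add: matricize_def)
qed

lemma dim_matricize [simp]:
  "dim_row (matricize d p k X) = p k"
  "dim_col (matricize d p k X) = (\<Prod>j\<in>{..<d} - {k}. p j)"
  by (simp_all add: matricize_def)

lemma bij_fiber_of_column:
  "bij_betw (fiber_of_column d p k) {..<(\<Prod>j\<in>{..<d} - {k}. p j)} (fibers d p k)"
proof -
  define N where "N n = (\<Prod>j\<in>{..<n} - {k}. p j)" for n
  have inj: "inj_on (fiber_of_column d p k) {..<N d}"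
  proof (rule inj_onI)
    fix c c' assume c: "c \<in> {..<N d}" "c' \<in> {..<N d}"
      and eq: "fiber_of_column d p k c = fiber_of_column d p k c'"
    \<comment> \<open>The digits below \<open>n\<close> determine the residue modulo
      \<open>N n\<close>; for \<open>n = d\<close> the residue is the number itself.\<close>
    have "n \<le> d \<Longrightarrow> c mod N n = c' mod N n" for n
    proof (induction n)
      case (Suc n)
      show ?case
      proof (cases "n = k")
        case True
        then have "{..<Suc n} - {k} = {..<n} - {k}" by auto
        then show ?thesis using Suc by (simp add: N_def)
      next
        case False
        then have "{..<Suc n} - {k} = insert n ({..<n} - {k})" by auto
        then have N: "N (Suc n) = N n * p n" by (simp add: N_def)
        have "(c div N n) mod p n = (c' div N n) mod p n"
          using fun_cong[OF eq, of n] False Suc.prems by (simp add: fiber_of_column_def N_def)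
        then show ?thesis using Suc unfolding N mod_mult2_eq by simp
      qed
    qed (simp add: N_def)
    from this[of d] show "c = c'" using c by simp
  qed
  have sub: "fiber_of_column d p k ` {..<N d} \<subseteq> fibers d p k"
  proof (rule image_subsetI)
    fix c assume "c \<in> {..<N d}"
    \<comment> \<open>A column exists, so no dimension other than that of mode \<open>k\<close> is
      0, and reducing modulo \<open>p l\<close> gives a digit below \<open>p l\<close>.\<close>
    then have "N d \<noteq> 0" by auto
    then have "p l \<noteq> 0" if "l \<in> {..<d} - {k}" for l
      using that by (auto simp: N_def)
    then show "fiber_of_column d p k c \<in> fibers d p k"
      unfolding fiber_of_column_def fibers_def by (auto simp: PiE_iff)
  qed
  \<comment> \<open>Equal cardinalities turn the injection into a bijection, without an explicit
    inverse.\<close>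
  have "card (fiber_of_column d p k ` {..<N d}) = card (fibers d p k)"
    using inj by (simp add: card_image fibers_def card_PiE N_def)
  moreover have "finite (fibers d p k)" by (auto simp: fibers_def intro: finite_PiE)
  ultimately show ?thesis
    using inj sub card_subset_eq unfolding bij_betw_def N_def by blast
qed

lemma fro_sq_matricize:
  assumes k: "k < d"
  shows "fro_sq (matricize d p k X) = (fro_norm d p X)\<^sup>2"
proof -
  let ?N = "\<Prod>j\<in>{..<d} - {k}. p j"
  have "fro_sq (matricize d p k X) = (\<Sum>a<p k. \<Sum>c<?N. (X ((fiber_of_column d p k c)(k := a)))\<^sup>2)"
    unfolding fro_sq_def dim_matricize using k by (intro sum.cong) (auto simp: matricize_index)
  also have "\<dots> = (\<Sum>c<?N. \<Sum>a<p k. (X ((fiber_of_column d p k c)(k := a)))\<^sup>2)"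
    by (rule sum.swap)
  also have "\<dots> = (\<Sum>i\<in>fibers d p k. \<Sum>a<p k. (X (i(k := a)))\<^sup>2)"
    by (rule sum.reindex_bij_betw[OF bij_fiber_of_column])
  also have "\<dots> = (fro_norm d p X)\<^sup>2"
    unfolding fro_norm_sq tensor_inner_def sum_multi_indices_fibers[OF k] by (simp add: power2_eq_square)
  finally show ?thesis .
qed

lemma fiber_of_column_upd: "fiber_of_column d (p(k := m)) k = fiber_of_column d p k"
proof -
  have "(\<Prod>j\<in>{..<l} - {k}. (p(k := m)) j) = (\<Prod>j\<in>{..<l} - {k}. p j)" for l
    by (rule prod.cong) auto
  then show ?thesis by (auto simp: fiber_of_column_def fun_eq_iff)
qed

lemma matricize_mode_prod:
  assumes A: "A \<in> carrier_mat m n" and k: "k < d" and m: "p k = m"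
  shows "matricize d p k (mode_prod k A X) = A * matricize d (p(k := n)) k X"
proof -
  have N: "(\<Prod>j\<in>{..<d} - {k}. (p(k := n)) j) = (\<Prod>j\<in>{..<d} - {k}. p j)"
    by (rule prod.cong) auto
  show ?thesis
  proof (rule eq_matI)
    fix a c assume "a < dim_row (A * matricize d (p(k := n)) k X)"
      and "c < dim_col (A * matricize d (p(k := n)) k X)"
    then have a: "a < m" and c: "c < (\<Prod>j\<in>{..<d} - {k}. p j)" using A by (auto simp del: fun_upd_apply simp: N)
    have "matricize d p k (mode_prod k A X) $$ (a, c)
        = (\<Sum>b<n. A $$ (a, b) * X ((fiber_of_column d p k c)(k := b)))"
      using A a c k m by (simp add: matricize_index mode_prod_fiber)
    also have "\<dots> = (\<Sum>b<n. A $$ (a, b) * matricize d (p(k := n)) k X $$ (b, c))"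
    proof (rule sum.cong)
      fix b assume b: "b \<in> {..<n}"
      have "matricize d (p(k := n)) k X $$ (b, c) = X ((fiber_of_column d (p(k := n)) k c)(k := b))"
        using b c k N by (intro matricize_index) (auto simp del: fun_upd_apply simp: fun_upd_same)
      then show "A $$ (a, b) * X ((fiber_of_column d p k c)(k := b)) = A $$ (a, b) * matricize d (p(k := n)) k X $$ (b, c)"
        by (simp only: fiber_of_column_upd)
    qed simp
    also have "\<dots> = (A * matricize d (p(k := n)) k X) $$ (a, c)"
    proof -
      have "B \<in> carrier_mat n l \<Longrightarrow> c < l \<Longrightarrow> (\<Sum>b<n. A $$ (a, b) * B $$ (b, c)) = (A * B) $$ (a, c)" for B l
        using A a by (simp add: scalar_prod_def lessThan_atLeast0)
      moreover have "matricize d (p(k := n)) k X \<in> carrier_mat n (\<Prod>j\<in>{..<d} - {k}. p j)"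
        unfolding carrier_mat_def mem_Collect_eq dim_matricize N by simp
      ultimately show ?thesis using c by blast
    qed
    finally show "matricize d p k (mode_prod k A X) $$ (a, c) = (A * matricize d (p(k := n)) k X) $$ (a, c)" .
  qed (use A m N in \<open>auto simp del: fun_upd_apply\<close>)
qed

section \<open>Rank bounds and optimality of the best approximation\<close>

text \<open>The matricization factors through \<open>V\<close>, which has only \<open>n\<close>
  columns.\<close>

lemma tucker_rank_mode_prod_le:
  assumes V: "V \<in> carrier_mat (p k) n" and k: "k < d"
  shows "tucker_rank d p (mode_prod k V X) k \<le> n"
proof -
  let ?M = "matricize d (p(k := n)) k X"
  have M: "?M \<in> carrier_mat n (dim_col ?M)" unfolding carrier_mat_def by simp
  show ?thesis unfolding tucker_rank_def matricize_mode_prod[where p = p, OF V k refl]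
    using vec_space.rank_mult_le[OF V M] vec_space.rank_le_nc[OF V] by (rule order_trans)
qed

text \<open>Scaling is right multiplication by a multiple of the identity. Only an inequality can
  hold, because \<open>c = 0\<close> is allowed.\<close>

lemma tucker_rank_scale_le: "tucker_rank d p (\<lambda>i. c * X i) k \<le> tucker_rank d p X k"
proof -
  let ?M = "matricize d p k X"
  let ?N = "\<Prod>j\<in>{..<d} - {k}. p j"
  have M: "?M \<in> carrier_mat (p k) ?N" unfolding carrier_mat_def by simp
  have "matricize d p k (\<lambda>i. c * X i) = c \<cdot>\<^sub>m ?M"
    by (intro eq_matI) (auto simp: matricize_def)
  also have "\<dots> = ?M * (c \<cdot>\<^sub>m 1\<^sub>m ?N)"
    using M mult_smult_distrib[OF M one_carrier_mat, of c] by simp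
  finally have "matricize d p k (\<lambda>i. c * X i) = ?M * (c \<cdot>\<^sub>m 1\<^sub>m ?N)" .
  then show ?thesis
    unfolding tucker_rank_def using vec_space.rank_mult_le[OF M, of "c \<cdot>\<^sub>m 1\<^sub>m ?N" ?N] by simp
qed

text \<open>Optimality along the ray through the optimum makes the residual orthogonal to it, and along
  the ray through any other competitor it gives the Cauchy--Schwarz type bound.\<close>

lemma best_tucker_approx_inner_le:
  assumes best: "is_best_tucker_approx d p r Z Y"
    and X: "X \<in> tensors d p" and rank: "\<And>k. k < d \<Longrightarrow> tucker_rank d p X k \<le> r k"
  shows "tensor_inner d p Z X \<le> fro_norm d p Y * fro_norm d p X"
proof -
  define N where "N = tensor_inner d p Z Z"
  have expand: "(fro_norm d p (tensor_diff Z (\<lambda>i. t * W i)))\<^sup>2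
      = N - 2 * t * tensor_inner d p Z W + t\<^sup>2 * (fro_norm d p W)\<^sup>2" for t W
    unfolding fro_norm_sq N_def tensor_inner_def tensor_diff_def sum_distrib_left
      sum_subtractf[symmetric] sum.distrib[symmetric]
    by (intro sum.cong) (auto simp: power2_eq_square algebra_simps)
  have opt: "N - 2 * tensor_inner d p Z Y + (fro_norm d p Y)\<^sup>2
      \<le> N - 2 * t * tensor_inner d p Z W + t\<^sup>2 * (fro_norm d p W)\<^sup>2"
    if W: "W \<in> tensors d p" "\<And>k. k < d \<Longrightarrow> tucker_rank d p W k \<le> r k" for t W
  proof -
    have "(\<lambda>i. t * W i) \<in> tensors d p" using W by (simp add: tensors_def)
    moreover have "tucker_rank d p (\<lambda>i. t * W i) k \<le> r k" if "k < d" for k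
      using tucker_rank_scale_le W(2)[OF that] by (rule order_trans)
    ultimately have "fro_norm d p (tensor_diff Z Y) \<le> fro_norm d p (tensor_diff Z (\<lambda>i. t * W i))"
      using best by (simp add: is_best_tucker_approx_def)
    then have "(fro_norm d p (tensor_diff Z Y))\<^sup>2 \<le> (fro_norm d p (tensor_diff Z (\<lambda>i. t * W i)))\<^sup>2"
      by (simp add: power_mono)
    then show ?thesis using expand[of 1 Y] expand[of t W] by simp
  qed
  have Y: "Y \<in> tensors d p" "\<And>k. k < d \<Longrightarrow> tucker_rank d p Y k \<le> r k"
    using best by (auto simp: is_best_tucker_approx_def)
  define y c where "y = fro_norm d p Y" and "c = tensor_inner d p Z Y"
  have y0: "0 \<le> y" by (simp add: y_def)
  have c: "c \<le> y\<^sup>2"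
  proof (cases "y = 0")
    case True
    have "c \<le> fro_norm d p Z * y" unfolding c_def y_def by (rule tensor_inner_le)
    then show ?thesis using True by simp
  next
    case False
    \<comment> \<open>The factor \<open>c / y\<^sup>2\<close> minimizes the quadratic in
      \<open>t\<close> along the ray through \<open>Y\<close>.\<close>
    have "2 * (c / y\<^sup>2) * c - (c / y\<^sup>2)\<^sup>2 * y\<^sup>2 \<le> 2 * c - y\<^sup>2"
      using opt[OF Y, of "c / y\<^sup>2"] by (simp add: c_def y_def)
    moreover have "2 * (c / y\<^sup>2) * c - (c / y\<^sup>2)\<^sup>2 * y\<^sup>2 = c\<^sup>2 / y\<^sup>2"
      using False by (simp add: field_simps power2_eq_square)
    ultimately have "c\<^sup>2 / y\<^sup>2 \<le> 2 * c - y\<^sup>2" by simp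
    then have "c\<^sup>2 \<le> (2 * c - y\<^sup>2) * y\<^sup>2"
      using False by (simp add: pos_divide_le_eq)
    \<comment> \<open>The inequality is a complete square, so in fact \<open>c = y\<^sup>2\<close>:
      the residual is orthogonal to \<open>Y\<close>.\<close>
    then have "(c - y\<^sup>2)\<^sup>2 \<le> 0" by (simp add: power2_eq_square algebra_simps)
    then show ?thesis by simp
  qed
  define x e where "x = fro_norm d p X" and "e = tensor_inner d p Z X"
  have x0: "0 \<le> x" by (simp add: x_def)
  show ?thesis
  proof (cases "x = 0")
    case True
    then show ?thesis using tensor_inner_le[of d p Z X] by (simp add: x_def)
  next
    case False
    \<comment> \<open>The same minimizing factor on the ray through \<open>X\<close>; by the bound
      on \<open>c\<close> the right side is at most \<open>y\<^sup>2\<close>.\<close>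
    have "2 * (e / x\<^sup>2) * e - (e / x\<^sup>2)\<^sup>2 * x\<^sup>2 \<le> 2 * c - y\<^sup>2"
      using opt[OF X rank, of "e / x\<^sup>2"] by (simp add: c_def y_def e_def x_def)
    moreover have "2 * (e / x\<^sup>2) * e - (e / x\<^sup>2)\<^sup>2 * x\<^sup>2 = e\<^sup>2 / x\<^sup>2"
      using False by (simp add: field_simps power2_eq_square)
    ultimately have "e\<^sup>2 / x\<^sup>2 \<le> y\<^sup>2" using c by simp
    then have "e\<^sup>2 \<le> (y * x)\<^sup>2"
      using False by (simp add: pos_divide_le_eq power_mult_distrib)
    then have "e \<le> y * x" using y0 x0 by (meson mult_nonneg_nonneg power2_le_imp_le)
    then show ?thesis by (simp add: e_def x_def y_def)
  qed
qed

section \<open>Residual of the signal after the singular value step\<close>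

text \<open>The assumption \<open>bound\<close> serves the two small bases of the exchange identity:
  \<open>W\<close>, with at most \<open>m\<close> columns, carries the residual, and
  \<open>V\<close>, with at most \<open>r\<close> columns, is orthogonal to the signal
  \<open>A\<close>.\<close>

lemma svd_projection_residual_le:
  assumes k: "k < d" and A: "A \<in> tensors d q" and E: "E = tensor_diff M A"
    and U: "U \<in> orthonormal_cols (q k) m" and UA: "mode_prod k (proj_mat U) A = A" and mr: "m \<le> r"
    and svd: "is_SVD_left r (matricize d q k M) Q"
    and bound: "\<And>V l. l \<le> r \<Longrightarrow> V \<in> orthonormal_cols (q k) l \<Longrightarrow>
      fro_norm d q (mode_prod k (proj_mat V) E) \<le> z"
  shows "fro_norm d q (tensor_diff A (mode_prod k (proj_mat Q) A)) \<le> 2 * z"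
proof -
  have Q: "Q \<in> orthonormal_cols (q k) r" using is_SVD_left_orthonormal[OF svd] by simp
  obtain W m' V r' where W: "m' \<le> m" "W \<in> orthonormal_cols (q k) m'"
    and V: "r' \<le> r" "V \<in> orthonormal_cols (q k) r'"
    and UV: "transpose_mat U * V = 0\<^sub>m m r'"
    and res: "(1\<^sub>m (q k) - proj_mat Q) * U = proj_mat W * U"
    and exch: "proj_mat Q + proj_mat W = proj_mat U + proj_mat V"
    by (rule proj_mat_sum_exchange[OF Q U]) (rule that, assumption+)
  note Qc = orthonormal_colsD[OF Q] and Uc = orthonormal_colsD[OF U]
    and Wc = orthonormal_colsD[OF W(2)] and Vc = orthonormal_colsD[OF V(2)]
  note P = proj_mat_carrier[OF Qc(1)] proj_mat_carrier[OF Uc(1)] proj_mat_carrier[OF Wc(1)]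
    proj_mat_carrier[OF Vc(1)]
  have z0: "0 \<le> z" using bound[OF V] fro_norm_nonneg order_trans by blast
  have "tensor_diff A (mode_prod k (proj_mat Q) A) = mode_prod k (1\<^sub>m (q k) - proj_mat Q) A"
    using mode_prod_minus_mat[OF one_carrier_mat P(1)] mode_prod_one[OF A k] by simp
  \<comment> \<open>Inserting the projection onto \<open>U\<close>, which fixes \<open>A\<close>,
    lets the residual operator be replaced by \<open>proj_mat W\<close>.\<close>
  also have "\<dots> = mode_prod k ((1\<^sub>m (q k) - proj_mat Q) * proj_mat U) A"
    using mode_prod_mult[of "1\<^sub>m (q k) - proj_mat Q" "q k" "q k" "proj_mat U" "q k" k A] P UA
    by (simp add: minus_carrier_mat)
  also have "(1\<^sub>m (q k) - proj_mat Q) * proj_mat U = proj_mat W * proj_mat U"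
  proof -
    have "(1\<^sub>m (q k) - proj_mat Q) * (U * transpose_mat U) = (1\<^sub>m (q k) - proj_mat Q) * U * transpose_mat U"
      using P Uc by (subst assoc_mult_mat[of _ "q k" "q k" _ m _ "q k"]) (auto simp: minus_carrier_mat)
    also have "\<dots> = proj_mat W * (U * transpose_mat U)"
      unfolding res using P Uc by (subst assoc_mult_mat[of _ "q k" "q k" _ m _ "q k"]) auto
    finally show ?thesis by (simp add: proj_mat_def[of U])
  qed
  also have "mode_prod k (proj_mat W * proj_mat U) A = mode_prod k (proj_mat W) A"
    using mode_prod_mult[OF P(3) P(2), of k A] UA by simp
  also have "\<dots> = tensor_diff (mode_prod k (proj_mat W) M) (mode_prod k (proj_mat W) E)"
    unfolding E mode_prod_diff by (simp add: tensor_diff_def)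
  finally have "fro_norm d q (tensor_diff A (mode_prod k (proj_mat Q) A))
      \<le> fro_norm d q (mode_prod k (proj_mat W) M) + fro_norm d q (mode_prod k (proj_mat W) E)"
    using fro_norm_diff_le by simp
  also have "fro_norm d q (mode_prod k (proj_mat W) E) \<le> z"
    using bound[OF _ W(2)] W(1) mr by simp
  also have "fro_norm d q (mode_prod k (proj_mat W) M) \<le> z"
  proof -
    \<comment> \<open>These squared norms are linear in the projection, so the exchange identity
      becomes an identity between four numbers.\<close>
    define n where "n X = (fro_norm d q (mode_prod k (proj_mat X) M))\<^sup>2" for X
    have n_eq: "n X = tensor_inner d q M (mode_prod k (proj_mat X) M)"
      if "X \<in> orthonormal_cols (q k) l" for X l
      unfolding n_def using fro_norm_proj_sq[of k d X q l M] k that by simp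
    have n_fro: "n X = fro_sq (transpose_mat X * matricize d q k M)"
      if X: "X \<in> orthonormal_cols (q k) l" for X l
    proof -
      have "n X = (fro_norm d (q(k := l)) (mode_prod k (transpose_mat X) M))\<^sup>2"
        unfolding n_def using fro_norm_proj_sq_compressed[of k d X q l M] k X by simp
      also have "\<dots> = fro_sq (matricize d (q(k := l)) k (mode_prod k (transpose_mat X) M))"
        by (rule fro_sq_matricize[OF k, symmetric])
      also have "matricize d (q(k := l)) k (mode_prod k (transpose_mat X) M)
          = transpose_mat X * matricize d q k M"
        using matricize_mode_prod[of "transpose_mat X" l "q k" k d "q(k := l)" M] k
          orthonormal_colsD(1)[OF X] by simp
      finally show ?thesis .
    qed
    have sum: "n Q + n W = n U + n V"
    proof -
      have "tensor_inner d q M (mode_prod k (B + C) M)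
          = tensor_inner d q M (mode_prod k B M) + tensor_inner d q M (mode_prod k C M)"
        if "B \<in> carrier_mat (q k) (q k)" "C \<in> carrier_mat (q k) (q k)" for B C
        unfolding tensor_inner_def mode_prod_add_mat[OF that]
        by (simp add: sum.distrib distrib_left)
      then show ?thesis
        unfolding n_eq[OF Q] n_eq[OF U] n_eq[OF W(2)] n_eq[OF V(2)] using P exch by metis
    qed
    have "n U \<le> n Q"
      unfolding n_fro[OF U] n_fro[OF Q] using ky_fan[OF svd _ mr] U by simp
    then have "n W \<le> n V" using sum by simp
    also have "n V \<le> z\<^sup>2"
    proof -
      \<comment> \<open>\<open>V\<close> is orthogonal to \<open>U\<close>, hence does not see
        \<open>A\<close>: on its range \<open>M\<close> and \<open>E\<close> coincide.\<close>
      have VU: "transpose_mat V * U = 0\<^sub>m r' m"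
        using arg_cong[OF UV, of transpose_mat] Uc Vc
        by (subst (asm) transpose_mult[of _ m "q k" _ r']) auto
      have "proj_mat V * proj_mat U = 0\<^sub>m (q k) (q k)"
      proof -
        have "proj_mat V * proj_mat U = V * (transpose_mat V * (U * transpose_mat U))"
          unfolding proj_mat_def using Vc Uc by (subst assoc_mult_mat[of _ "q k" r' _ "q k" _ "q k"]) auto
        also have "transpose_mat V * (U * transpose_mat U) = 0\<^sub>m r' (q k)"
          using Vc Uc VU by (subst assoc_mult_mat[of _ r' "q k" _ m _ "q k", symmetric]) auto
        finally show ?thesis using Vc by simp
      qed
      then have "mode_prod k (proj_mat V) A = (\<lambda>_. 0)"
        using mode_prod_mult[OF P(4) P(2), of k A] UA by (simp add: mode_prod_zero_mat)
      then have "mode_prod k (proj_mat V) E = mode_prod k (proj_mat V) M"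
        unfolding E mode_prod_diff by (simp add: tensor_diff_def)
      then show ?thesis unfolding n_def using bound[OF V] by (simp add: power_mono)
    qed
    finally show ?thesis unfolding n_def using z0 by (rule power2_le_imp_le)
  qed
  finally show ?thesis by simp
qed

section \<open>Norm loss under compression\<close>

text \<open>The blocks \<open>U\<close> and \<open>V\<close> side by side form a square matrix
  \<open>H\<close> with orthonormal columns, and its left inverse is also a right inverse.\<close>

lemma orthonormal_complement_sum:
  assumes U: "U \<in> orthonormal_cols p r" and comp: "orthonormal_complement p r U V" and r: "r \<le> p"
  shows "U * transpose_mat U + V * transpose_mat V = 1\<^sub>m p"
proof -
  note Uc = orthonormal_colsD[OF U]
  have V: "V \<in> orthonormal_cols p (p - r)" and UV: "transpose_mat U * V = 0\<^sub>m r (p - r)"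
    using comp by (auto simp: orthonormal_complement_def)
  note Vc = orthonormal_colsD[OF V]
  define H where "H = mat p p (\<lambda>(i, j). if j < r then U $$ (i, j) else V $$ (i, j - r))"
  have H: "H \<in> carrier_mat p p" by (simp add: H_def)
  have col1: "col H j = col U j" if "j < r" for j
    using that r Uc by (intro eq_vecI) (auto simp: H_def)
  have col2: "col H j = col V (j - r)" if "r \<le> j" "j < p" for j
    using that r Vc by (intro eq_vecI) (auto simp: H_def)
  have "transpose_mat H * H = 1\<^sub>m p"
  proof (rule eq_matI)
    fix i j assume "i < dim_row (1\<^sub>m p :: real mat)" "j < dim_col (1\<^sub>m p :: real mat)"
    then have ij: "i < p" "j < p" by auto
    have uu: "col U i \<bullet> col U j = (if i = j then 1 else 0)" if "i < r" "j < r"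
      using arg_cong[OF Uc(2), of "\<lambda>M. M $$ (i, j)"] that Uc(1) by simp
    have vv: "col V (i - r) \<bullet> col V (j - r) = (if i = j then 1 else 0)" if "r \<le> i" "r \<le> j"
    proof -
      have "i - r < p - r" "j - r < p - r" using that ij by auto
      moreover have "i - r = j - r \<longleftrightarrow> i = j" using that by auto
      ultimately show ?thesis
        using arg_cong[OF Vc(2), of "\<lambda>M. M $$ (i - r, j - r)"] Vc(1) by simp
    qed
    have uv: "col U a \<bullet> col V (b - r) = 0" if "a < r" "r \<le> b" "b < p" for a b
    proof -
      have "b - r < p - r" using that by auto
      then show ?thesis
        using arg_cong[OF UV, of "\<lambda>M. M $$ (a, b - r)"] that Uc(1) Vc(1) by simp
    qed
    have "(transpose_mat H * H) $$ (i, j) = col H i \<bullet> col H j" using ij H by simp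
    also have "\<dots> = (if i = j then 1 else 0)"
    proof -
      consider "i < r" "j < r" | "i < r" "r \<le> j" | "r \<le> i" "j < r" | "r \<le> i" "r \<le> j" by linarith
      then show ?thesis
      proof cases
        case 1
        then show ?thesis using uu by (simp add: col1)
      next
        case 2
        then show ?thesis using uv ij by (simp add: col1 col2)
      next
        case 3
        have "col V (i - r) \<bullet> col U j = col U j \<bullet> col V (i - r)"
          by (rule comm_scalar_prod[of _ p]) (use Uc Vc in auto)
        then show ?thesis using 3 uv[of j i] ij by (simp add: col1 col2)
      next
        case 4
        then show ?thesis using vv ij by (simp add: col2)
      qed
    qed
    finally show "(transpose_mat H * H) $$ (i, j) = 1\<^sub>m p $$ (i, j)" using ij by simp
  qed (use H in auto)
  then have HH: "H * transpose_mat H = 1\<^sub>m p"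
    using H mat_mult_left_right_inverse[of "transpose_mat H" p H] by simp
  show ?thesis
  proof (rule eq_matI)
    fix i j assume "i < dim_row (1\<^sub>m p :: real mat)" "j < dim_col (1\<^sub>m p :: real mat)"
    then have ij: "i < p" "j < p" by auto
    have "(H * transpose_mat H) $$ (i, j) = (\<Sum>l<p. H $$ (i, l) * H $$ (j, l))"
      using ij H by (simp add: scalar_prod_def lessThan_atLeast0)
    also have "\<dots> = (\<Sum>l<r. H $$ (i, l) * H $$ (j, l)) + (\<Sum>l=r..<p. H $$ (i, l) * H $$ (j, l))"
      using r sum.atLeastLessThan_concat[of 0 r p "\<lambda>l. H $$ (i, l) * H $$ (j, l)"]
      by (simp add: lessThan_atLeast0)
    also have "(\<Sum>l<r. H $$ (i, l) * H $$ (j, l)) = (U * transpose_mat U) $$ (i, j)"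
      using ij Uc r by (simp add: scalar_prod_def lessThan_atLeast0 H_def)
    also have "(\<Sum>l=r..<p. H $$ (i, l) * H $$ (j, l)) = (\<Sum>l<p - r. V $$ (i, l) * V $$ (j, l))"
      using ij r by (intro sum.reindex_bij_witness[of _ "\<lambda>l. l + r" "\<lambda>l. l - r"]) (auto simp: H_def)
    also have "\<dots> = (V * transpose_mat V) $$ (i, j)"
      using ij Vc by (simp add: scalar_prod_def lessThan_atLeast0)
    finally show "(U * transpose_mat U + V * transpose_mat V) $$ (i, j) = 1\<^sub>m p $$ (i, j)"
      using HH ij Uc Vc by simp
  qed (use Uc Vc in auto)
qed

lemma vec_norm2_sq: "(vec_norm2 x)\<^sup>2 = x \<bullet> x"
  unfolding vec_norm2_def by (simp add: scalar_prod_def sum_nonneg)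

lemma vec_norm2_nonneg: "0 \<le> vec_norm2 x"
  unfolding vec_norm2_def by (simp add: scalar_prod_def sum_nonneg)

lemma vec_norm2_smult: "vec_norm2 (c \<cdot>\<^sub>v x) = \<bar>c\<bar> * vec_norm2 x"
proof -
  have "(c \<cdot>\<^sub>v x) \<bullet> (c \<cdot>\<^sub>v x) = c\<^sup>2 * (x \<bullet> x)" by (simp add: power2_eq_square mult.assoc)
  then show ?thesis by (simp add: vec_norm2_def real_sqrt_mult)
qed

text \<open>The supremum bounds its set only if the set is bounded above; \<open>bdd\<close>
  supplies this with an arbitrary constant. Rescaling to norm 1 then gives the estimate.\<close>

lemma vec_norm2_mult_le_spectral_norm:
  assumes A: "A \<in> carrier_mat m n" and bdd: "\<And>x. x \<in> carrier_vec n \<Longrightarrow> vec_norm2 (A *\<^sub>v x) \<le> C * vec_norm2 x"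
    and x: "x \<in> carrier_vec n"
  shows "vec_norm2 (A *\<^sub>v x) \<le> spectral_norm A * vec_norm2 x"
proof -
  let ?S = "{vec_norm2 (A *\<^sub>v x) | x. x \<in> carrier_vec (dim_col A) \<and> vec_norm2 x \<le> 1}"
  have "bdd_above ?S"
  \<comment> \<open>\<open>C\<close> may be negative; the maximum with 0 keeps the bound monotone in
    the norm of \<open>x\<close>.\<close>
  proof (rule bdd_aboveI[of _ "max C 0"])
    fix y assume "y \<in> ?S"
    then obtain x where x: "x \<in> carrier_vec n" "vec_norm2 x \<le> 1" "y = vec_norm2 (A *\<^sub>v x)"
      using A by auto
    have "y \<le> C * vec_norm2 x" using bdd x by simp
    also have "\<dots> \<le> max C 0 * vec_norm2 x" by (intro mult_right_mono vec_norm2_nonneg) simp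
    also have "\<dots> \<le> max C 0 * 1" by (intro mult_left_mono x) simp
    finally show "y \<le> max C 0" by simp
  qed
  then have sup: "vec_norm2 (A *\<^sub>v x) \<le> spectral_norm A" if "x \<in> carrier_vec n" "vec_norm2 x \<le> 1" for x
    unfolding spectral_norm_def using that A by (intro cSup_upper) auto
  show ?thesis
  proof (cases "vec_norm2 x = 0")
    case True
    then show ?thesis using bdd[OF x] by simp
  next
    case False
    define c where "c = vec_norm2 x"
    have c: "0 < c" using False vec_norm2_nonneg[of x] by (simp add: c_def)
    have "vec_norm2 (A *\<^sub>v (inverse c \<cdot>\<^sub>v x)) \<le> spectral_norm A"
      using x c by (intro sup) (auto simp: vec_norm2_smult c_def)
    then have "inverse c * vec_norm2 (A *\<^sub>v x) \<le> spectral_norm A"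
      using c A x by (simp add: mult_mat_vec vec_norm2_smult)
    then show ?thesis using c by (simp add: field_simps c_def[symmetric])
  qed
qed

text \<open>By Pythagoras the squared norm of \<open>x\<close> splits into its parts along
  \<open>U0\<close> and along \<open>V\<close>. Since \<open>x\<close> is in the range of
  \<open>U\<close>, the closeness assumption leaves at most half of it to \<open>V\<close>.\<close>

lemma scalar_prod_le_compressed:
  assumes U: "U \<in> orthonormal_cols p m" and U0: "U0 \<in> orthonormal_cols p r" and r: "r \<le> p"
    and comp: "orthonormal_complement p r U0 V"
    and close: "spectral_norm (transpose_mat V * U) \<le> sqrt 2 / 2"
    and x: "x \<in> carrier_vec p" and Ux: "proj_mat U *\<^sub>v x = x"
  shows "x \<bullet> x \<le> 2 * ((transpose_mat U0 *\<^sub>v x) \<bullet> (transpose_mat U0 *\<^sub>v x))"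
proof -
  have V: "V \<in> orthonormal_cols p (p - r)" using comp by (simp add: orthonormal_complement_def)
  note Uc = orthonormal_colsD[OF U] and U0c = orthonormal_colsD[OF U0] and Vc = orthonormal_colsD[OF V]
  have adj: "(transpose_mat B *\<^sub>v v) \<bullet> (transpose_mat B *\<^sub>v v) = (B * transpose_mat B *\<^sub>v v) \<bullet> v"
    if "B \<in> carrier_mat p n" "v \<in> carrier_vec p" for B :: "real mat" and v n
  proof -
    have "(B * transpose_mat B *\<^sub>v v) \<bullet> v = v \<bullet> (B *\<^sub>v (transpose_mat B *\<^sub>v v))"
      using that by (subst assoc_mult_mat_vec[of _ p n _ p]) (auto intro!: comm_scalar_prod[of _ p])
    also have "\<dots> = (transpose_mat B *\<^sub>v v) \<bullet> (transpose_mat B *\<^sub>v v)"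
      using transpose_vec_mult_scalar[OF that(1) _ that(2), of "transpose_mat B *\<^sub>v v"] that by simp
    finally show ?thesis by simp
  qed
  have pyth: "v \<bullet> v = (transpose_mat U0 *\<^sub>v v) \<bullet> (transpose_mat U0 *\<^sub>v v)
      + (transpose_mat V *\<^sub>v v) \<bullet> (transpose_mat V *\<^sub>v v)" if v: "v \<in> carrier_vec p" for v
  proof -
    have "v = (U0 * transpose_mat U0 + V * transpose_mat V) *\<^sub>v v"
      unfolding orthonormal_complement_sum[OF U0 comp r] using v by simp
    also have "\<dots> = U0 * transpose_mat U0 *\<^sub>v v + V * transpose_mat V *\<^sub>v v"
      using U0c Vc v by (subst add_mult_distrib_mat_vec[of _ p p]) auto
    finally have eq: "v = U0 * transpose_mat U0 *\<^sub>v v + V * transpose_mat V *\<^sub>v v" .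
    have "v \<bullet> v = (U0 * transpose_mat U0 *\<^sub>v v + V * transpose_mat V *\<^sub>v v) \<bullet> v"
      using eq by simp
    also have "\<dots> = (U0 * transpose_mat U0 *\<^sub>v v) \<bullet> v + (V * transpose_mat V *\<^sub>v v) \<bullet> v"
      using U0c(1) Vc(1) v by (intro add_scalar_prod_distrib[of _ p]) auto
    finally show ?thesis using adj[OF U0c(1) v] adj[OF Vc(1) v] by simp
  qed
  have nonneg: "0 \<le> w \<bullet> w" for w :: "real vec" by (simp add: scalar_prod_def sum_nonneg)
  have iso: "(U *\<^sub>v y) \<bullet> (U *\<^sub>v y) = y \<bullet> y" if y: "y \<in> carrier_vec m" for y
  proof -
    have "(U *\<^sub>v y) \<bullet> (U *\<^sub>v y) = (transpose_mat U *\<^sub>v (U *\<^sub>v y)) \<bullet> y"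
      using transpose_vec_mult_scalar[OF Uc(1) y, of "U *\<^sub>v y"] Uc y by simp
    also have "transpose_mat U *\<^sub>v (U *\<^sub>v y) = y"
      using Uc y by (subst assoc_mult_mat_vec[of _ m p _ m, symmetric]) auto
    finally show ?thesis .
  qed
  define y where "y = transpose_mat U *\<^sub>v x"
  have y: "y \<in> carrier_vec m" using Uc x by (simp add: y_def)
  have xy: "x = U *\<^sub>v y"
    using Ux Uc x unfolding y_def proj_mat_def by (subst (asm) assoc_mult_mat_vec[of _ p m _ p]) auto
  have VUw: "transpose_mat V * U *\<^sub>v w = transpose_mat V *\<^sub>v (U *\<^sub>v w)" if "w \<in> carrier_vec m" for w
    using Uc Vc that by (intro assoc_mult_mat_vec[of _ "p - r" p _ m]) auto
  have "vec_norm2 (transpose_mat V * U *\<^sub>v y) \<le> spectral_norm (transpose_mat V * U) * vec_norm2 y"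
  \<comment> \<open>The constant 1 certifies boundedness: \<open>U\<close> is an isometry, and the
    transpose of \<open>V\<close> contracts by \<open>pyth\<close>.\<close>
  proof (rule vec_norm2_mult_le_spectral_norm[of _ "p - r" m 1])
    fix w :: "real vec" assume w: "w \<in> carrier_vec m"
    have "(transpose_mat V * U *\<^sub>v w) \<bullet> (transpose_mat V * U *\<^sub>v w) \<le> w \<bullet> w"
      unfolding VUw[OF w] using pyth[of "U *\<^sub>v w"] iso[OF w] nonneg[of "transpose_mat U0 *\<^sub>v (U *\<^sub>v w)"] Uc w
      by simp
    then show "vec_norm2 (transpose_mat V * U *\<^sub>v w) \<le> 1 * vec_norm2 w"
      by (simp add: vec_norm2_def)
  qed (use Uc Vc y in auto)
  also have "\<dots> \<le> sqrt 2 / 2 * vec_norm2 y"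
    by (intro mult_right_mono close vec_norm2_nonneg)
  finally have "(vec_norm2 (transpose_mat V *\<^sub>v x))\<^sup>2 \<le> (sqrt 2 / 2 * vec_norm2 y)\<^sup>2"
    unfolding VUw[OF y] xy[symmetric] by (intro power_mono vec_norm2_nonneg)
  also have "\<dots> = (y \<bullet> y) / 2" by (simp add: power_mult_distrib vec_norm2_sq power_divide)
  also have "y \<bullet> y = x \<bullet> x" using iso[OF y] xy by simp
  finally show ?thesis using pyth[OF x] by (simp add: vec_norm2_sq)
qed

text \<open>The vector estimate, summed over all mode-\<open>k\<close> fibres; each fibre of
  \<open>X\<close> lies in the range of \<open>U\<close>.\<close>

lemma fro_norm_le_compressed:
  assumes k: "k < d" and X: "mode_prod k (proj_mat U) X = X"
    and U: "U \<in> orthonormal_cols (p k) m" and U0: "U0 \<in> orthonormal_cols (p k) r" and r: "r \<le> p k"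
    and comp: "orthonormal_complement (p k) r U0 V"
    and close: "spectral_norm (transpose_mat V * U) \<le> sqrt 2 / 2"
  shows "fro_norm d p X \<le> sqrt 2 * fro_norm d (p(k := r)) (mode_prod k (transpose_mat U0) X)"
proof -
  define f where "f i = vec (p k) (\<lambda>a. X (i(k := a)))" for i
  note Uc = orthonormal_colsD[OF U] and U0c = orthonormal_colsD[OF U0]
  have mv: "A *\<^sub>v f i = vec n (\<lambda>a. mode_prod k A X (i(k := a)))" if "A \<in> carrier_mat n (p k)" for A n i
    using that by (intro eq_vecI) (auto simp: f_def mode_prod_fiber scalar_prod_def lessThan_atLeast0)
  have sq: "vec n g \<bullet> vec n g = (\<Sum>a<n. (g a)\<^sup>2)" for n and g :: "nat \<Rightarrow> real"
    by (simp add: scalar_prod_def power2_eq_square lessThan_atLeast0)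
  have fix': "proj_mat U *\<^sub>v f i = f i" for i
    using mv[OF proj_mat_carrier[OF Uc(1)], of i] X by (simp add: f_def)
  have fc: "f i \<in> carrier_vec (p k)" for i by (simp add: f_def)
  have "(fro_norm d p X)\<^sup>2 = (\<Sum>i\<in>fibers d p k. f i \<bullet> f i)"
    unfolding fro_norm_sq tensor_inner_def sum_multi_indices_fibers[OF k] f_def sq
    by (simp add: power2_eq_square)
  also have "\<dots> \<le> (\<Sum>i\<in>fibers d p k. 2 * ((transpose_mat U0 *\<^sub>v f i) \<bullet> (transpose_mat U0 *\<^sub>v f i)))"
    by (intro sum_mono scalar_prod_le_compressed[OF U U0 r comp close fc fix'])
  also have "\<dots> = 2 * (\<Sum>i\<in>fibers d p k. \<Sum>a<r. (mode_prod k (transpose_mat U0) X (i(k := a)))\<^sup>2)"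
    using U0c(1) by (simp add: mv[of _ r] sq sum_distrib_left)
  also have "\<dots> = 2 * (fro_norm d (p(k := r)) (mode_prod k (transpose_mat U0) X))\<^sup>2"
    unfolding fro_norm_sq tensor_inner_def sum_multi_indices_fibers[OF k] fibers_upd
    by (simp add: power2_eq_square)
  also have "\<dots> = (sqrt 2 * fro_norm d (p(k := r)) (mode_prod k (transpose_mat U0) X))\<^sup>2"
    by (simp add: power_mult_distrib)
  finally show ?thesis by (rule power2_le_imp_le) simp
qed

section \<open>Projections of the noise\<close>

lemma mode_prods_fixed:
  "(\<And>k. k \<in> set ks \<Longrightarrow> mode_prod k (A k) X = X) \<Longrightarrow> mode_prods ks A X = X"
  by (induction ks) auto

text \<open>The factorizations make \<open>X\<close> a competitor of admissible rank, and
  \<open>inner\<close> holds when \<open>X\<close> is an orthogonal projection of \<open>Z\<close>;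
  one factor of the norm of \<open>X\<close> then cancels.\<close>

lemma best_tucker_approx_factor_le:
  assumes best: "is_best_tucker_approx d p r Z Y" and X: "X \<in> tensors d p"
    and factor: "\<And>k. k < d \<Longrightarrow> \<exists>V n X'. V \<in> carrier_mat (p k) n \<and> n \<le> r k \<and> X = mode_prod k V X'"
    and inner: "tensor_inner d p Z X = (fro_norm d p X)\<^sup>2"
  shows "fro_norm d p X \<le> fro_norm d p Y"
proof -
  have "tucker_rank d p X k \<le> r k" if k: "k < d" for k
    using factor[OF k] tucker_rank_mode_prod_le[where p = p, OF _ k] order_trans by blast
  from best_tucker_approx_inner_le[OF best X this]
  have "fro_norm d p X * fro_norm d p X \<le> fro_norm d p Y * fro_norm d p X"
    by (simp add: inner power2_eq_square)
  then show ?thesis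
    by (metis fro_norm_nonneg mult_le_cancel_right order_le_less)
qed

lemma fro_norm_mode_prods_proj_le:
  assumes best: "is_best_tucker_approx d p r Z Y" and Z: "Z \<in> tensors d p"
    and Q: "\<And>k. k < d \<Longrightarrow> Q k \<in> orthonormal_cols (p k) (r k)"
  shows "fro_norm d p (mode_prods [0..<d] (\<lambda>k. proj_mat (Q k)) Z) \<le> fro_norm d p Y"
proof -
  let ?P = "\<lambda>k. proj_mat (Q k)"
  let ?X = "mode_prods [0..<d] ?P Z"
  have P: "?P k \<in> carrier_mat (p k) (p k)" if "k < d" for k
    using proj_mat_carrier orthonormal_colsD(1)[OF Q[OF that]] by blast
  have over: "override_on p p S = p" for S by (simp add: override_on_def fun_eq_iff)
  have fixed: "mode_prod k (?P k) ?X = ?X" if k: "k < d" for k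
  proof -
    obtain X' where "?X = mode_prod k (?P k) X'" using mode_prods_factor[of k "[0..<d]" ?P Z] k by auto
    then show ?thesis using mode_prod_proj_idem[of k d "Q k" p, OF k Q[OF k]] by simp
  qed
  show ?thesis
  proof (rule best_tucker_approx_factor_le[OF best])
    show "?X \<in> tensors d p"
      using mode_prods_tensors[OF Z, of "[0..<d]" ?P p] P over by (simp add: atLeast0LessThan)
    show "\<exists>V n X'. V \<in> carrier_mat (p k) n \<and> n \<le> r k \<and> ?X = mode_prod k V X'" if k: "k < d" for k
    proof (intro exI conjI)
      note Qc = orthonormal_colsD(1)[OF Q[OF k]]
      show "Q k \<in> carrier_mat (p k) (r k)" by (rule Qc)
      \<comment> \<open>Being fixed by the projection, \<open>?X\<close> factors through the
        \<open>r k\<close> columns of \<open>Q k\<close>.\<close>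
      show "?X = mode_prod k (Q k) (mode_prod k (transpose_mat (Q k)) ?X)"
        using fixed[OF k] Qc by (simp add: mode_prod_mult[of _ "p k" "r k" _ "p k"] proj_mat_def)
    qed simp
    have "(fro_norm d p ?X)\<^sup>2 = tensor_inner d (override_on p p (set [0..<d])) ?X ?X"
      by (simp add: fro_norm_sq over)
    also have "\<dots> = tensor_inner d p Z (mode_prods (rev [0..<d]) (\<lambda>k. transpose_mat (?P k)) ?X)"
      using P by (intro tensor_inner_mode_prods) auto
    \<comment> \<open>The projections are symmetric, and each of them fixes
      \<open>?X\<close>.\<close>
    also have "mode_prods (rev [0..<d]) (\<lambda>k. transpose_mat (?P k)) ?X = ?X"
      using fixed by (intro mode_prods_fixed) (simp add: transpose_proj_mat)
    finally show "tensor_inner d p Z ?X = (fro_norm d p ?X)\<^sup>2" ..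
  qed
qed

text \<open>The compressed tensor \<open>W\<close> is lifted back to full size by the isometries
  \<open>U0 j\<close>. The lift \<open>X\<close> keeps the norm, has admissible rank in every mode,
  and is a projection of \<open>Z\<close>.\<close>

lemma fro_norm_compressed_proj_le:
  assumes best: "is_best_tucker_approx d p r Z Y" and Z: "Z \<in> tensors d p" and k: "k < d"
    and U0: "\<And>j. j < d \<Longrightarrow> U0 j \<in> orthonormal_cols (p j) (r j)"
    and V: "V \<in> orthonormal_cols (p k) l" and l: "l \<le> r k"
    and ks: "distinct ks" "set ks = {..<d} - {k}"
  shows "fro_norm d (r(k := p k)) (mode_prod k (proj_mat V) (mode_prods ks (\<lambda>j. transpose_mat (U0 j)) Z))
    \<le> fro_norm d p Y"
proof -
  let ?q = "r(k := p k)" and ?A = "\<lambda>j. transpose_mat (U0 j)"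
  define E where "E = mode_prods ks ?A Z"
  define W where "W = mode_prod k (proj_mat V) E"
  define X where "X = mode_prods (rev ks) U0 W"
  have U0c: "U0 j \<in> carrier_mat (p j) (r j)" if "j \<in> set ks" for j
    using orthonormal_colsD(1)[OF U0] that ks by auto
  have Vc: "V \<in> carrier_mat (?q k) l" using orthonormal_colsD(1)[OF V] by simp
  have q: "override_on p r (set ks) j = ?q j" if "j < d" for j
    using that ks by (auto simp: override_on_def)
  have p: "override_on ?q p (set ks) j = p j" if "j < d" for j
    using that ks by (auto simp: override_on_def)
  have "E \<in> tensors d (override_on p r (set ks))"
    unfolding E_def by (rule mode_prods_tensors[OF Z ks(1)]) (use U0c ks in auto)
  also have "tensors d (override_on p r (set ks)) = tensors d ?q"
    by (rule tensors_cong) (rule q)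
  finally have E: "E \<in> tensors d ?q" .
  have W: "W \<in> tensors d ?q"
    using mode_prod_tensors[OF E proj_mat_carrier[OF Vc] k]
    unfolding W_def by (simp only: fun_upd_triv)
  have "X \<in> tensors d (override_on ?q p (set (rev ks)))"
    unfolding X_def by (rule mode_prods_tensors[OF W]) (use U0c ks in auto)
  also have "tensors d (override_on ?q p (set (rev ks))) = tensors d p"
    unfolding set_rev by (rule tensors_cong) (rule p)
  finally have X: "X \<in> tensors d p" .
  have "fro_norm d p X = fro_norm d (override_on ?q p (set (rev ks))) X"
    unfolding set_rev by (rule fro_norm_cong) (rule p[symmetric])
  also have "\<dots> = fro_norm d ?q W"
    unfolding X_def by (rule fro_norm_mode_prods_isometry[OF W]) (use U0 ks in auto)
  finally have nX: "fro_norm d p X = fro_norm d ?q W" .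
  have "fro_norm d p X \<le> fro_norm d p Y"
  proof (rule best_tucker_approx_factor_le[OF best X])
    fix j assume j: "j < d"
    show "\<exists>V n X'. V \<in> carrier_mat (p j) n \<and> n \<le> r j \<and> X = mode_prod j V X'"
    \<comment> \<open>Mode \<open>k\<close> factors through \<open>V\<close>, which has
      \<open>l\<close> columns, and any other mode \<open>j\<close> through \<open>U0 j\<close>,
      which has \<open>r j\<close>.\<close>
    proof (cases "j = k")
      case True
      have "X = mode_prod k (proj_mat V) (mode_prods (rev ks) U0 E)"
        unfolding X_def W_def using ks by (intro mode_prods_commute) auto
      also have "\<dots> = mode_prod k V (mode_prod k (transpose_mat V) (mode_prods (rev ks) U0 E))"
        unfolding proj_mat_def using Vc by (intro mode_prod_mult[symmetric]) auto
      finally show ?thesis using True Vc l by auto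
    next
      case False
      then show ?thesis using mode_prods_factor[of j "rev ks" U0 W] ks j U0c[of j] unfolding X_def by auto
    qed
  next
    \<comment> \<open>Moved across the inner product, the lift becomes the compression of
      \<open>Z\<close>.\<close>
    have "tensor_inner d p Z X = tensor_inner d (override_on p r (set ks)) E W"
      unfolding E_def X_def using U0c ks
      by (subst tensor_inner_mode_prods) auto
    also have "\<dots> = tensor_inner d ?q E W" by (rule tensor_inner_cong) (rule q)
    also have "\<dots> = (fro_norm d ?q W)\<^sup>2"
      unfolding W_def using fro_norm_proj_sq[of k d V ?q l E] k V by simp
    finally show "tensor_inner d p Z X = (fro_norm d p X)\<^sup>2" by (simp add: nX)
  qed
  then show ?thesis unfolding nX W_def E_def .
qed

section \<open>Telescoping over the modes and the error bound\<close>

text \<open>Adding the projection in mode \<open>n\<close> costs the residual of \<open>X\<close> in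
  that mode; the error accumulated before does not grow, since projections are contractions.\<close>

lemma fro_norm_diff_mode_prods_proj_le:
  assumes Q: "\<And>k. k < d \<Longrightarrow> Q k \<in> orthonormal_cols (p k) (m k)" and "n \<le> d"
  shows "fro_norm d p (tensor_diff X (mode_prods [0..<n] (\<lambda>k. proj_mat (Q k)) X))
    \<le> (\<Sum>k<n. fro_norm d p (tensor_diff X (mode_prod k (proj_mat (Q k)) X)))"
  using assms(2)
proof (induction n)
  case 0
  show ?case by (simp add: fro_norm_def tensor_diff_def)
next
  case (Suc n)
  let ?Y = "mode_prods [0..<n] (\<lambda>k. proj_mat (Q k)) X" and ?P = "mode_prod n (proj_mat (Q n))"
  have n: "n < d" using Suc.prems by simp
  have "fro_norm d p (tensor_diff X (?P ?Y))
      \<le> fro_norm d p (tensor_diff X (?P X)) + fro_norm d p (tensor_diff (?P X) (?P ?Y))"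
    by (rule fro_norm_diff_triangle)
  also have "fro_norm d p (tensor_diff (?P X) (?P ?Y)) \<le> fro_norm d p (tensor_diff X ?Y)"
    unfolding mode_prod_diff[symmetric] by (rule fro_norm_proj_le[of n d "Q n" p, OF n Q[OF n]])
  also have "\<dots> \<le> (\<Sum>k<n. fro_norm d p (tensor_diff X (mode_prod k (proj_mat (Q k)) X)))"
    using Suc by simp
  finally show ?case by simp
qed

theorem theorem10:
  fixes d :: nat
    and p r rstar :: "nat \<Rightarrow> nat"
    and Ttilde T B Z Zmax That :: tensor
    and U U0 U0perp :: "nat \<Rightarrow> real mat"
  assumes Ttilde: "Ttilde \<in> tensors d p"
    and T: "T \<in> tensors d p"
    and T_rank: "\<And>k. k < d \<Longrightarrow> tucker_rank d p T k = rstar k"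
    and B: "B \<in> tensors d rstar"
    and U: "\<And>k. k < d \<Longrightarrow> U k \<in> orthonormal_cols (p k) (rstar k)"
    and T_decomp: "T = mode_prods [0..<d] U B"
    and Z: "Z = tensor_diff Ttilde T"
    and r_ge: "\<And>k. k < d \<Longrightarrow> rstar k \<le> r k"
    and U0: "\<And>k. k < d \<Longrightarrow> U0 k \<in> orthonormal_cols (p k) (r k)"
    and U0perp: "\<And>k. k < d \<Longrightarrow> orthonormal_complement (p k) (r k) (U0 k) (U0perp k)"
    and U0_close: "\<And>k. k < d \<Longrightarrow> spectral_norm (transpose_mat (U0perp k) * U k) \<le> sqrt 2 / 2"
    and That: "is_OHOOI_output d p r Ttilde U0 That"
    and Zmax: "is_best_tucker_approx d p r Z Zmax"
  shows "fro_norm d p (tensor_diff That T)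
           \<le> (2 powr ((real d + 1) / 2) * real d + 1) * fro_norm d p Zmax"
proof -
  let ?ks = "\<lambda>k. [0..<k] @ [Suc k..<d]" and ?A = "\<lambda>j. transpose_mat (U0 j)"
  define z where "z = fro_norm d p Zmax"
  obtain Q where svd: "\<And>k. k < d \<Longrightarrow> is_SVD_left (r k)
        (matricize d (r(k := p k)) k (mode_prods (?ks k) ?A Ttilde)) (Q k)"
    and That_eq: "That = mode_prods [0..<d] (\<lambda>k. proj_mat (Q k)) Ttilde"
    using That unfolding is_OHOOI_output_def by blast
  have Q: "Q k \<in> orthonormal_cols (p k) (r k)" if "k < d" for k
    using is_SVD_left_orthonormal[OF svd[OF that]] by simp
  \<comment> \<open>The bound is part of \<open>is_SVD_left\<close>; it makes
    \<open>p k - r k\<close> in the complement a true difference.\<close>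
  have rp: "r k \<le> p k" if "k < d" for k
    using svd[OF that] by (simp add: is_SVD_left_def)
  have Zt: "Z \<in> tensors d p" using T Ttilde by (simp add: Z tensors_def tensor_diff_def)
  have UT: "mode_prod k (proj_mat (U k)) T = T" if k: "k < d" for k
  proof -
    obtain X' where X': "T = mode_prod k (U k) X'"
      unfolding T_decomp using mode_prods_factor[of k "[0..<d]" U B] k by auto
    note Uc = orthonormal_colsD(1)[OF U[OF k]]
    show ?thesis unfolding X'
      using mode_prod_mult[OF proj_mat_carrier[OF Uc] Uc] proj_mat_mult_self(1)[OF U[OF k]] by simp
  qed
  have mode: "fro_norm d p (tensor_diff T (mode_prod k (proj_mat (Q k)) T)) \<le> 2 powr ((real d + 1) / 2) * z"
    if k: "k < d" for k
  proof -
    let ?q = "r(k := p k)" and ?P = "mode_prod k (proj_mat (Q k))"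
    define S where "S = tensor_diff T (?P T)"
    have ks: "distinct (?ks k)" "set (?ks k) = {..<d} - {k}" "length (?ks k) = d - 1"
      using k by auto
    have q: "override_on p r (set (?ks k)) j = ?q j" if "j < d" for j
      using that unfolding ks(2) by (auto simp: override_on_def)
    have A: "?A j \<in> carrier_mat (r j) (p j)" if "j \<in> set (?ks k)" for j
      using orthonormal_colsD(1)[OF U0[of j]] that unfolding ks(2) by simp
    have PT: "?P T \<in> tensors d p"
      using mode_prod_tensors[of T d p "proj_mat (Q k)" "p k" k, OF T _ k]
        proj_mat_carrier[OF orthonormal_colsD(1)[OF Q[OF k]]] by simp
    have S: "S \<in> tensors d p" using T PT by (simp add: S_def tensors_def tensor_diff_def)
    \<comment> \<open>The residual in mode \<open>k\<close> stays in the range of \<open>U j\<close>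
      for the other modes, so each of the \<open>d - 1\<close> compressions loses a factor of at
      most \<open>sqrt 2\<close>.\<close>
    have US: "mode_prod j (proj_mat (U j)) S = S" if "j \<in> set (?ks k)" for j
    proof -
      have j: "j < d" "j \<noteq> k" using that unfolding ks(2) by auto
      show ?thesis unfolding S_def mode_prod_diff mode_prod_commute[OF j(2)] UT[OF j(1)] ..
    qed
    have "fro_norm d p S \<le> sqrt 2 ^ length (?ks k) *
        fro_norm d (override_on p r (set (?ks k))) (mode_prods (?ks k) ?A S)"
    proof (rule fro_norm_le_mode_prods[where P = "\<lambda>j. proj_mat (U j)"])
      fix j q' Y assume j: "j \<in> set (?ks k)" and q': "q' j = p j"
        and fixed: "mode_prod j (proj_mat (U j)) Y = Y"
      have jd: "j < d" using j unfolding ks(2) by simp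
      show "fro_norm d q' Y \<le> sqrt 2 * fro_norm d (q'(j := r j)) (mode_prod j (?A j) Y)"
        by (rule fro_norm_le_compressed[where V = "U0perp j", OF jd fixed])
          (use U U0 U0perp U0_close rp q' jd in auto)
    qed (use S US A ks in auto)
    also have "fro_norm d (override_on p r (set (?ks k))) (mode_prods (?ks k) ?A S)
        = fro_norm d ?q (mode_prods (?ks k) ?A S)"
      by (rule fro_norm_cong) (rule q)
    \<comment> \<open>The projection in mode \<open>k\<close> commutes with compressions in other
      modes, so the compressed residual is the residual of the compressed signal.\<close>
    also have "mode_prods (?ks k) ?A S
        = tensor_diff (mode_prods (?ks k) ?A T) (?P (mode_prods (?ks k) ?A T))"
      unfolding S_def mode_prods_diff by (subst mode_prods_commute) (auto simp: ks(2))
    also have "fro_norm d ?q \<dots> \<le> 2 * z"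
    proof (rule svd_projection_residual_le[OF k _ _ _ _ r_ge[OF k] svd[OF k]])
      show "mode_prods (?ks k) ?A T \<in> tensors d ?q"
      proof -
        have "mode_prods (?ks k) ?A T \<in> tensors d (override_on p r (set (?ks k)))"
          by (rule mode_prods_tensors[OF T ks(1)]) (use A ks(2) in auto)
        also have "tensors d (override_on p r (set (?ks k))) = tensors d ?q"
          by (rule tensors_cong) (rule q)
        finally show ?thesis .
      qed
      show "U k \<in> orthonormal_cols (?q k) (rstar k)" using U[OF k] by simp
      have "k \<notin> set (?ks k)" unfolding ks(2) by simp
      from mode_prods_commute[OF this, of ?A "proj_mat (U k)" T]
      show "mode_prod k (proj_mat (U k)) (mode_prods (?ks k) ?A T) = mode_prods (?ks k) ?A T"
        using UT[OF k] by simp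
      show "mode_prods (?ks k) ?A Z = tensor_diff (mode_prods (?ks k) ?A Ttilde) (mode_prods (?ks k) ?A T)"
        unfolding Z mode_prods_diff ..
      show "fro_norm d ?q (mode_prod k (proj_mat V) (mode_prods (?ks k) ?A Z)) \<le> z"
        if "l \<le> r k" "V \<in> orthonormal_cols (?q k) l" for V l
        unfolding z_def using that U0 ks
        by (intro fro_norm_compressed_proj_le[OF Zmax Zt k]) auto
    qed
    finally have "fro_norm d p S \<le> sqrt 2 ^ length (?ks k) * (2 * z)"
      by (simp add: mult_left_mono)
    also have "\<dots> = sqrt 2 ^ (d - 1) * (2 * z)" by (simp only: ks(3))
    \<comment> \<open>The factor 2 supplies two more powers of \<open>sqrt 2\<close>;
      \<open>d\<close> is positive because \<open>k < d\<close>, so \<open>d - 1\<close> is not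
      truncated.\<close>
    also have "sqrt 2 ^ (d - 1) * (2 * z) = sqrt 2 ^ (d + 1) * z"
    proof -
      obtain n where "d = Suc n" using k by (cases d) auto
      then show ?thesis by simp
    qed
    also have "sqrt 2 ^ (d + 1) = (2 :: real) powr ((real d + 1) / 2)"
    proof -
      have "sqrt 2 ^ (d + 1) = ((2 :: real) powr (1 / 2)) powr real (d + 1)"
        by (subst powr_realpow) (simp_all add: powr_half_sqrt)
      also have "\<dots> = 2 powr ((real d + 1) / 2)" by (simp add: powr_powr add.commute)
      finally show ?thesis .
    qed
    finally show ?thesis by (simp add: S_def)
  qed
  let ?M = "mode_prods [0..<d] (\<lambda>k. proj_mat (Q k))"
  \<comment> \<open>Splitting at \<open>?M T\<close> separates the projected noise, which
    contributes the summand 1, from the loss of signal, at most \<open>d\<close> single-mode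
    residuals.\<close>
  have "fro_norm d p (tensor_diff That T)
      \<le> fro_norm d p (tensor_diff (?M Ttilde) (?M T)) + fro_norm d p (tensor_diff (?M T) T)"
    unfolding That_eq by (rule fro_norm_diff_triangle)
  also have "fro_norm d p (tensor_diff (?M Ttilde) (?M T)) \<le> z"
    unfolding mode_prods_diff[symmetric] Z[symmetric] z_def
    by (rule fro_norm_mode_prods_proj_le[OF Zmax Zt Q])
  also have "fro_norm d p (tensor_diff (?M T) T) = fro_norm d p (tensor_diff T (?M T))"
    by (rule fro_norm_uminus)
  also have "\<dots> \<le> (\<Sum>k<d. fro_norm d p (tensor_diff T (mode_prod k (proj_mat (Q k)) T)))"
    by (rule fro_norm_diff_mode_prods_proj_le[OF Q order_refl])
  also have "\<dots> \<le> (\<Sum>k<d. 2 powr ((real d + 1) / 2) * z)"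
    using mode by (intro sum_mono) simp
  finally show ?thesis by (simp add: z_def algebra_simps)
qed

end
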